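(* The first-order theory $WT_{Rel}$ is interpretable in the first-order theory $VW^+$ (both defined in the context).
   Context: Interpretable means (relatively) formally interpretable in the usual sense. Both theories include the usual axioms for identity. $WT_{Rel}$: Let $\mathcal{L}_T=\{0,(\cdot,\cdot),\sqsubseteq\}$ with $0$ a constant and $(\cdot,\cdot)$ a binary function symbol; its variable-free terms are $0,(0,0),(0,(0,0)),\dots$, and $\mathcal{S}[t]$ is the set of all subterms of the variable-free term $t$ (including $t$). The vocabulary of $WT_{Rel}$ has a constant $\underline{t}$ for each variable-free $\mathcal{L}_T$-term $t$, a ternary relation symbol $T$ and a binary relation symbol $\sqsubseteq$. Axioms: (1) $\neg\,\underline{s}=\underline{t}$ for distinct variable-free $\mathcal{L}_T$-terms $s,t$; (2) $\forall x(x\sqsubseteq\underline{t}\leftrightarrow\bigvee_{s\in\mathcal{S}[t]}x=\underline{s})$ for each variable-free $\mathcal{L}_T$-term $t$; (3) $T(\underline{s},\underline{t},\underline{(s,t)})$ for variable-free $\mathcal{L}_T$-terms $s,t$; (4) $\forall x,y\,\exists z\,T(x,y,z)$; (5) $\forall x,y,u,v\,(T(x,y,u)\ \&\ T(x,y,v)\to u=v)$. $VW^+$: $\Sigma^*$ is the set of finite words over $\{1,2\}$, including the empty word $e$; $^\frown$ is concatenation; $lh(s)$ is the length of $s$; $s^{-1}$ its reversal; $2^m$ the string of $m$ consecutive 2's ($2^0=e$). Signature $\{\underline{e},S_1,S_2,f,\sqsubseteq,|{\le}|\}$ ($\underline{e}$ a constant, $S_1,S_2,f$ unary functions, $\sqsubseteq,|{\le}|$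 binary relations). The canonical term of $e$ is $\underline{e}$, and $\underline{w^\frown d}$ is $S_d(\underline{w})$ for $d\in\{1,2\}$. Axioms: (VW1) $\neg\,\underline{s}=\underline{t}$ for distinct $s,t\in\Sigma^*$; (VW2) $S_d(\underline{t})=\underline{t^\frown d}$ for $t\in\Sigma^*$, $d=1,2$; (VW3) $\underline{e}\sqsubseteq\underline{t}$ for $t\in\Sigma^*$; (VW4) $\forall x(x\sqsubseteq\underline{e}\to x=\underline{e})$; (VW5) $\forall x(x\sqsubseteq S_d(\underline{t})\leftrightarrow x\sqsubseteq\underline{t}\vee x=S_d(\underline{t}))$ for $t\in\Sigma^*$, $d=1,2$; (VW6) $\forall x(x\,|{\le}|\,\underline{2^m}\leftrightarrow\bigvee_{lh(s)\le m}x=\underline{s})$ for $m\ge0$; (VW7) $\exists y\,(y\,|{\le}|\,\underline{t})\to\forall x(x\sqsubseteq\underline{t}\ \&\ x\ne\underline{e}\to\underline{2}\sqsubseteq f(x))$ for $t\in\Sigma^*$; (VW8) $f(\underline{t})=\underline{t^{-1}}$ for $t\in\Sigma^*$; (VW9) $\forall x,y(f(x)=f(y)\to x=y)$; (VW10) $\forall x,y(x\sqsubseteq y\ \&\ y\sqsubseteq x\to x=y)$. *)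

theory Defs
  imports Main
begin

section \<open>First-order logic with identity\<close>

text \<open>Variables are de Bruijn indices, so \<open>Forall \<phi>\<close> binds index 0 of \<open>\<phi>\<close>.  All elements of the
  types \<open>'f\<close> and \<open>'r\<close> are function and relation symbols; constants are function symbols of
  arity 0.\<close>

record ('f, 'r) language =
  fun_arity :: "'f \<Rightarrow> nat"
  rel_arity :: "'r \<Rightarrow> nat"

datatype 'f tm = Var nat | Fn 'f "'f tm list"

datatype ('f, 'r) fm =
    Falsum
  | Eq "'f tm" "'f tm"
  | Rel 'r "'f tm list"
  | Imp "('f, 'r) fm" "('f, 'r) fm"
  | Forall "('f, 'r) fm"

abbreviation Neg :: "('f, 'r) fm \<Rightarrow> ('f, 'r) fm" where
  "Neg \<phi> \<equiv> Imp \<phi> Falsum"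

abbreviation Or :: "('f, 'r) fm \<Rightarrow> ('f, 'r) fm \<Rightarrow> ('f, 'r) fm" where
  "Or \<phi> \<psi> \<equiv> Imp (Neg \<phi>) \<psi>"

abbreviation And :: "('f, 'r) fm \<Rightarrow> ('f, 'r) fm \<Rightarrow> ('f, 'r) fm" where
  "And \<phi> \<psi> \<equiv> Neg (Imp \<phi> (Neg \<psi>))"

abbreviation Iff :: "('f, 'r) fm \<Rightarrow> ('f, 'r) fm \<Rightarrow> ('f, 'r) fm" where
  "Iff \<phi> \<psi> \<equiv> And (Imp \<phi> \<psi>) (Imp \<psi> \<phi>)"

abbreviation Exists :: "('f, 'r) fm \<Rightarrow> ('f, 'r) fm" where
  "Exists \<phi> \<equiv> Neg (Forall (Neg \<phi>))"

definition Disj :: "('f, 'r) fm list \<Rightarrow> ('f, 'r) fm" where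
  "Disj \<phi>s = foldr Or \<phi>s Falsum"

definition Foralls :: "nat \<Rightarrow> ('f, 'r) fm \<Rightarrow> ('f, 'r) fm" where
  "Foralls n = Forall ^^ n"

definition Existss :: "nat \<Rightarrow> ('f, 'r) fm \<Rightarrow> ('f, 'r) fm" where
  "Existss n = (\<lambda>\<phi>. Exists \<phi>) ^^ n"

fun wf_tm :: "('f, 'r) language \<Rightarrow> 'f tm \<Rightarrow> bool" where
  "wf_tm L (Var i) \<longleftrightarrow> True"
| "wf_tm L (Fn f ts) \<longleftrightarrow> length ts = fun_arity L f \<and> (\<forall>t\<in>set ts. wf_tm L t)"

fun wf_fm :: "('f, 'r) language \<Rightarrow> ('f, 'r) fm \<Rightarrow> bool" where
  "wf_fm L Falsum \<longleftrightarrow> True"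
| "wf_fm L (Eq s t) \<longleftrightarrow> wf_tm L s \<and> wf_tm L t"
| "wf_fm L (Rel r ts) \<longleftrightarrow> length ts = rel_arity L r \<and> (\<forall>t\<in>set ts. wf_tm L t)"
| "wf_fm L (Imp \<phi> \<psi>) \<longleftrightarrow> wf_fm L \<phi> \<and> wf_fm L \<psi>"
| "wf_fm L (Forall \<phi>) \<longleftrightarrow> wf_fm L \<phi>"

fun fv_tm :: "'f tm \<Rightarrow> nat set" where
  "fv_tm (Var i) = {i}"
| "fv_tm (Fn f ts) = (\<Union>t\<in>set ts. fv_tm t)"

fun fv_fm :: "('f, 'r) fm \<Rightarrow> nat set" where
  "fv_fm Falsum = {}"
| "fv_fm (Eq s t) = fv_tm s \<union> fv_tm t"
| "fv_fm (Rel r ts) = (\<Union>t\<in>set ts. fv_tm t)"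
| "fv_fm (Imp \<phi> \<psi>) = fv_fm \<phi> \<union> fv_fm \<psi>"
| "fv_fm (Forall \<phi>) = {i. Suc i \<in> fv_fm \<phi>}"

definition sentence :: "('f, 'r) language \<Rightarrow> ('f, 'r) fm \<Rightarrow> bool" where
  "sentence L \<phi> \<longleftrightarrow> wf_fm L \<phi> \<and> fv_fm \<phi> = {}"

fun subst_tm :: "(nat \<Rightarrow> 'f tm) \<Rightarrow> 'f tm \<Rightarrow> 'f tm" where
  "subst_tm \<sigma> (Var i) = \<sigma> i"
| "subst_tm \<sigma> (Fn f ts) = Fn f (map (subst_tm \<sigma>) ts)"

definition under_binder :: "(nat \<Rightarrow> 'f tm) \<Rightarrow> nat \<Rightarrow> 'f tm" where
  "under_binder \<sigma> = case_nat (Var 0) (\<lambda>i. subst_tm (\<lambda>j. Var (Suc j)) (\<sigma> i))"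

fun subst_fm :: "(nat \<Rightarrow> 'f tm) \<Rightarrow> ('f, 'r) fm \<Rightarrow> ('f, 'r) fm" where
  "subst_fm \<sigma> Falsum = Falsum"
| "subst_fm \<sigma> (Eq s t) = Eq (subst_tm \<sigma> s) (subst_tm \<sigma> t)"
| "subst_fm \<sigma> (Rel r ts) = Rel r (map (subst_tm \<sigma>) ts)"
| "subst_fm \<sigma> (Imp \<phi> \<psi>) = Imp (subst_fm \<sigma> \<phi>) (subst_fm \<sigma> \<psi>)"
| "subst_fm \<sigma> (Forall \<phi>) = Forall (subst_fm (under_binder \<sigma>) \<phi>)"

definition lift_fm :: "('f, 'r) fm \<Rightarrow> ('f, 'r) fm" where
  "lift_fm = subst_fm (\<lambda>i. Var (Suc i))"

text \<open>\<open>inst_fm \<phi> t\<close> replaces index 0 by \<open>t\<close> and decrements the other indices, as needed to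
  instantiate \<open>Forall \<phi>\<close>; \<open>app_fm \<phi> ts\<close> simultaneously replaces the indices
  \<open>0, \<dots>, length ts - 1\<close> and leaves the others alone.\<close>

definition inst_fm :: "('f, 'r) fm \<Rightarrow> 'f tm \<Rightarrow> ('f, 'r) fm" where
  "inst_fm \<phi> t = subst_fm (case_nat t Var) \<phi>"

definition app_fm :: "('f, 'r) fm \<Rightarrow> 'f tm list \<Rightarrow> ('f, 'r) fm" where
  "app_fm \<phi> ts = subst_fm (\<lambda>i. if i < length ts then ts ! i else Var i) \<phi>"

text \<open>Natural deduction for classical logic with identity, restricted to the formulas of the
  language \<open>L\<close>.  The set of assumptions may be infinite, so a theory is simply used as a set of
  assumptions.\<close>

inductive derives :: "('f, 'r) language \<Rightarrow> ('f, 'r) fm set \<Rightarrow> ('f, 'r) fm \<Rightarrow> bool"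
  ("_, _ \<turnstile> _" [51, 51, 51] 50) for L where
  Assm: "\<phi> \<in> \<Gamma> \<Longrightarrow> wf_fm L \<phi> \<Longrightarrow> L, \<Gamma> \<turnstile> \<phi>"
| ImpI: "wf_fm L \<phi> \<Longrightarrow> L, insert \<phi> \<Gamma> \<turnstile> \<psi> \<Longrightarrow> L, \<Gamma> \<turnstile> Imp \<phi> \<psi>"
| ImpE: "L, \<Gamma> \<turnstile> Imp \<phi> \<psi> \<Longrightarrow> L, \<Gamma> \<turnstile> \<phi> \<Longrightarrow> L, \<Gamma> \<turnstile> \<psi>"
| Contr: "wf_fm L \<phi> \<Longrightarrow> L, insert (Neg \<phi>) \<Gamma> \<turnstile> Falsum \<Longrightarrow> L, \<Gamma> \<turnstile> \<phi>"
| ForallI: "L, lift_fm ` \<Gamma> \<turnstile> \<phi> \<Longrightarrow> L, \<Gamma> \<turnstile> Forall \<phi>"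
| ForallE: "L, \<Gamma> \<turnstile> Forall \<phi> \<Longrightarrow> wf_tm L t \<Longrightarrow> L, \<Gamma> \<turnstile> inst_fm \<phi> t"
| EqI: "wf_tm L t \<Longrightarrow> L, \<Gamma> \<turnstile> Eq t t"
| EqE: "L, \<Gamma> \<turnstile> Eq s t \<Longrightarrow> wf_fm L \<phi> \<Longrightarrow> L, \<Gamma> \<turnstile> inst_fm \<phi> s \<Longrightarrow> L, \<Gamma> \<turnstile> inst_fm \<phi> t"

section \<open>Relative interpretations\<close>

text \<open>A one-dimensional, parameter-free relative translation in the sense of Tarski, Mostowski and
  Robinson.  The domain formula has free index 0; an \<open>n\<close>-ary relation symbol is translated by a
  formula whose arguments are the indices \<open>0, \<dots>, n - 1\<close>; an \<open>n\<close>-ary function symbol is translated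
  by a formula for its graph, with arguments \<open>0, \<dots>, n - 1\<close> and value \<open>n\<close>.  Identity is
  translated as identity.\<close>

record ('f, 'r, 'g, 's) translation =
  dom_tr :: "('g, 's) fm"
  fun_tr :: "'f \<Rightarrow> ('g, 's) fm"
  rel_tr :: "'r \<Rightarrow> ('g, 's) fm"

text \<open>Compound terms are eliminated through their values.  In the formulas \<open>vs\<close>, index 0 is the value
  of a term and index \<open>Suc j\<close> is index \<open>j + c\<close> of the context; then \<open>with_values I c vs \<psi>\<close> says, in
  that context, that there are values \<open>0, \<dots>, length vs - 1\<close> in the domain, as described by
  \<open>vs\<close>, such that \<open>\<psi>\<close>.\<close>

definition with_values ::
  "('f, 'r, 'g, 's) translation \<Rightarrow> nat \<Rightarrow> ('g, 's) fm list \<Rightarrow> ('g, 's) fm \<Rightarrow> ('g, 's) fm" where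
  "with_values I c vs \<psi> = (let n = length vs in
     Existss n (foldr And
       (map2 (\<lambda>i v. And (app_fm (dom_tr I) [Var i])
                        (subst_fm (case_nat (Var i) (\<lambda>j. Var (j + c + n))) v)) [0..<n] vs) \<psi>))"

text \<open>\<open>tr_tm I t\<close> says that index 0 is the value of \<open>t\<close>, with index \<open>j\<close> of \<open>t\<close> becoming
  \<open>Suc j\<close>.\<close>

fun tr_tm :: "('f, 'r, 'g, 's) translation \<Rightarrow> 'f tm \<Rightarrow> ('g, 's) fm" where
  "tr_tm I (Var j) = Eq (Var 0) (Var (Suc j))"
| "tr_tm I (Fn f ts) = with_values I 1 (map (tr_tm I) ts)
     (app_fm (fun_tr I f) (map Var [0..<Suc (length ts)]))"

fun tr_fm :: "('f, 'r, 'g, 's) translation \<Rightarrow> ('f, 'r) fm \<Rightarrow> ('g, 's) fm" where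
  "tr_fm I Falsum = Falsum"
| "tr_fm I (Eq s t) = with_values I 0 [tr_tm I s, tr_tm I t] (Eq (Var 0) (Var 1))"
| "tr_fm I (Rel r ts) = with_values I 0 (map (tr_tm I) ts)
     (app_fm (rel_tr I r) (map Var [0..<length ts]))"
| "tr_fm I (Imp \<phi> \<psi>) = Imp (tr_fm I \<phi>) (tr_fm I \<psi>)"
| "tr_fm I (Forall \<phi>) = Forall (Imp (app_fm (dom_tr I) [Var 0]) (tr_fm I \<phi>))"

definition wf_translation ::
  "('f, 'r) language \<Rightarrow> ('g, 's) language \<Rightarrow> ('f, 'r, 'g, 's) translation \<Rightarrow> bool" where
  "wf_translation L L' I \<longleftrightarrow>
     wf_fm L' (dom_tr I) \<and> fv_fm (dom_tr I) \<subseteq> {0} \<and>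
     (\<forall>f. wf_fm L' (fun_tr I f) \<and> fv_fm (fun_tr I f) \<subseteq> {..fun_arity L f}) \<and>
     (\<forall>r. wf_fm L' (rel_tr I r) \<and> fv_fm (rel_tr I r) \<subseteq> {..<rel_arity L r})"

definition dom_nonempty :: "('f, 'r, 'g, 's) translation \<Rightarrow> ('g, 's) fm" where
  "dom_nonempty I = Exists (app_fm (dom_tr I) [Var 0])"

text \<open>For all arguments in the domain there is exactly one value in the domain.\<close>

definition functional ::
  "('f, 'r) language \<Rightarrow> ('f, 'r, 'g, 's) translation \<Rightarrow> 'f \<Rightarrow> ('g, 's) fm" where
  "functional L I f = (let n = fun_arity L f; D = (\<lambda>i. app_fm (dom_tr I) [Var i]);
       F = (\<lambda>k v. app_fm (fun_tr I f) (map (\<lambda>i. Var (i + k)) [0..<n] @ [Var v]))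
     in Foralls n (foldr Imp (map D [0..<n])
          (Exists (And (And (D 0) (F 1 0))
             (Forall (Imp (And (D 0) (F 2 0)) (Eq (Var 0) (Var 1))))))))"

definition interpretable ::
  "('f, 'r) language \<Rightarrow> ('f, 'r) fm set \<Rightarrow> ('g, 's) language \<Rightarrow> ('g, 's) fm set \<Rightarrow> bool" where
  "interpretable L T L' T' \<longleftrightarrow>
     (\<exists>I. wf_translation L L' I \<and>
          L', T' \<turnstile> dom_nonempty I \<and>
          (\<forall>f. L', T' \<turnstile> functional L I f) \<and>
          (\<forall>\<phi>\<in>T. L', T' \<turnstile> tr_fm I \<phi>))"

section \<open>The theory of trees\<close>

text \<open>\<open>Zero\<close> and \<open>Br s t\<close> are the variable-free terms \<open>0\<close> and \<open>(s,t)\<close>.\<close>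

datatype tree = Zero | Br tree tree

fun subterms :: "tree \<Rightarrow> tree list" where
  "subterms Zero = [Zero]"
| "subterms (Br s t) = Br s t # remdups (subterms s @ subterms t)"

text \<open>\<open>Const t\<close>, \<open>Tern\<close> and \<open>Subtm\<close> are the symbols \<open>t\<close> (underlined), \<open>T\<close> and \<open>\<sqsubseteq>\<close>.\<close>

datatype wt_fun = Const tree
datatype wt_rel = Tern | Subtm

definition WT_lang :: "(wt_fun, wt_rel) language" where
  "WT_lang = \<lparr>fun_arity = (\<lambda>_. 0), rel_arity = case_wt_rel 3 2\<rparr>"

abbreviation cn :: "tree \<Rightarrow> wt_fun tm" where
  "cn t \<equiv> Fn (Const t) []"

inductive_set WT_Rel :: "(wt_fun, wt_rel) fm set" where
  WT1: "s \<noteq> t \<Longrightarrow> Neg (Eq (cn s) (cn t)) \<in> WT_Rel"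
| WT2: "Forall (Iff (Rel Subtm [Var 0, cn t])
                    (Disj (map (\<lambda>s. Eq (Var 0) (cn s)) (subterms t)))) \<in> WT_Rel"
| WT3: "Rel Tern [cn s, cn t, cn (Br s t)] \<in> WT_Rel"
| WT4: "Forall (Forall (Exists (Rel Tern [Var 2, Var 1, Var 0]))) \<in> WT_Rel"
| WT5: "Foralls 4 (Imp (And (Rel Tern [Var 3, Var 2, Var 1]) (Rel Tern [Var 3, Var 2, Var 0]))
                       (Eq (Var 1) (Var 0))) \<in> WT_Rel"

section \<open>The theory of words\<close>

datatype digit = One | Two

datatype vw_fun = Eps | S digit | Rv
datatype vw_rel = Sub | Len

text \<open>\<open>Rv\<close>, \<open>Sub\<close> and \<open>Len\<close> are the symbols \<open>f\<close>, \<open>\<sqsubseteq>\<close> and \<open>|\<le>|\<close>.\<close>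

definition VW_lang :: "(vw_fun, vw_rel) language" where
  "VW_lang = \<lparr>fun_arity = case_vw_fun 0 (\<lambda>_. 1) 1, rel_arity = (\<lambda>_. 2)\<rparr>"

text \<open>The canonical term of \<open>w @ [d]\<close> is \<open>Fn (S d) [canon w]\<close>.\<close>

definition canon :: "digit list \<Rightarrow> vw_fun tm" where
  "canon w = foldl (\<lambda>t d. Fn (S d) [t]) (Fn Eps []) w"

definition words_upto :: "nat \<Rightarrow> digit list list" where
  "words_upto m = concat (map (\<lambda>n. List.n_lists n [One, Two]) [0..<Suc m])"

inductive_set VW_plus :: "(vw_fun, vw_rel) fm set" where
  VW1: "s \<noteq> t \<Longrightarrow> Neg (Eq (canon s) (canon t)) \<in> VW_plus"
| VW2: "Eq (Fn (S d) [canon t]) (canon (t @ [d])) \<in> VW_plus"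
| VW3: "Rel Sub [canon [], canon t] \<in> VW_plus"
| VW4: "Forall (Imp (Rel Sub [Var 0, canon []]) (Eq (Var 0) (canon []))) \<in> VW_plus"
| VW5: "Forall (Iff (Rel Sub [Var 0, Fn (S d) [canon t]])
                    (Or (Rel Sub [Var 0, canon t]) (Eq (Var 0) (Fn (S d) [canon t]))))
        \<in> VW_plus"
| VW6: "Forall (Iff (Rel Len [Var 0, canon (replicate m Two)])
                    (Disj (map (\<lambda>s. Eq (Var 0) (canon s)) (words_upto m)))) \<in> VW_plus"
| VW7: "Imp (Exists (Rel Len [Var 0, canon t]))
            (Forall (Imp (And (Rel Sub [Var 0, canon t]) (Neg (Eq (Var 0) (canon []))))
                         (Rel Sub [canon [Two], Fn Rv [Var 0]]))) \<in> VW_plus"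
| VW8: "Eq (Fn Rv [canon t]) (canon (rev t)) \<in> VW_plus"
| VW9: "Forall (Forall (Imp (Eq (Fn Rv [Var 1]) (Fn Rv [Var 0])) (Eq (Var 1) (Var 0))))
        \<in> VW_plus"
| VW10: "Forall (Forall (Imp (And (Rel Sub [Var 1, Var 0]) (Rel Sub [Var 0, Var 1]))
                             (Eq (Var 1) (Var 0)))) \<in> VW_plus"

lemma wf_Disj [simp]: "wf_fm L (Disj \<phi>s) \<longleftrightarrow> (\<forall>\<phi>\<in>set \<phi>s. wf_fm L \<phi>)"
  by (induction \<phi>s) (auto simp: Disj_def)

lemma fv_Disj [simp]: "fv_fm (Disj \<phi>s) = (\<Union>\<phi>\<in>set \<phi>s. fv_fm \<phi>)"
  by (induction \<phi>s) (auto simp: Disj_def)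

lemma wf_canon [simp]: "wf_tm VW_lang (canon w)"
  by (induction w rule: rev_induct) (auto simp: canon_def VW_lang_def)

lemma fv_canon [simp]: "fv_tm (canon w) = {}"
  by (induction w rule: rev_induct) (auto simp: canon_def)

lemma set_words_upto: "set (words_upto m) = {s. length s \<le> m}"
proof -
  have [simp]: "{One, Two} = UNIV"
    using digit.exhaust by auto
  show ?thesis
    by (auto simp: words_upto_def set_n_lists simp del: upt_Suc)
qed

lemma sentence_WT_Rel: "\<phi> \<in> WT_Rel \<Longrightarrow> sentence WT_lang \<phi>"
  by (induction rule: WT_Rel.induct)
    (auto simp: sentence_def WT_lang_def Foralls_def numeral_eq_Suc less_Suc_eq split: nat.splits)

lemma sentence_VW_plus:
  assumes "\<phi> \<in> VW_plus"
  shows "sentence VW_lang \<phi>"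
proof -
  have [simp]: "fun_arity VW_lang (S d) = 1" "fun_arity VW_lang Rv = 1" "rel_arity VW_lang r = 2"
    for d r by (simp_all add: VW_lang_def)
  show ?thesis
    using assms by induction (simp_all add: sentence_def)
qed

end

theory Submission
  imports Defs "HOL-Library.Countable" "HOL-Library.Sublist"
begin

text \<open>
  By completeness it suffices to interpret trees uniformly in every model of \<open>VW\<^sup>+\<close>.  Such a model
  contains the standard words, on which prefix, suffix and reversal are correct, and the elements
  \<open>x |\<le>| 2\<^sup>m\<close> are exactly the standard words of length at most \<open>m\<close>.  Hence a formula whose
  quantifiers are bounded by \<open>2\<^sup>m\<close> has its standard meaning.  Concatenation has such a definition:
  \<open>z = uv\<close> says that \<open>u\<close> is a prefix and \<open>v\<close> a suffix of \<open>z\<close> and that the lengths add up, which is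
  expressed by a word \<open>2\<^sup>i 1 2\<^sup>j\<close>.  The tree \<open>0\<close> is coded by the empty word and \<open>(s,t)\<close> by \<open>p u p v p\<close>,
  where \<open>u\<close>, \<open>v\<close> code \<open>s\<close>, \<open>t\<close> and \<open>p = 1 2\<^sup>k 1\<close> is longer than \<open>uv\<close>; then the subterms of \<open>t\<close> are
  coded by the factors of the code of \<open>t\<close> that are empty or of the form \<open>p u p v p\<close>, with arbitrary
  words \<open>u\<close> and \<open>v\<close>.

  A suitable bound is definable even though the model may contain nonstandard elements.  If
  \<open>e \<sqsubseteq> y\<close>, and \<open>S\<^sub>2(x) \<sqsubseteq> y\<close> whenever \<open>x \<sqsubseteq> y\<close> and \<open>x \<noteq> y\<close>, then \<open>y\<close> is a standard \<open>2\<^sup>m\<close> or every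
  standard \<open>2\<^sup>m\<close> lies below \<open>y\<close>.  So if some standard \<open>2\<^sup>m\<close> is large enough, then a \<open>y\<close> with no large
  enough element strictly below it is standard.  The graph of pairing thus defined is correct at
  codes of trees, and wherever it fails to be functional, \<open>T\<close> takes the value \<open>e\<close>.
\<close>

section \<open>Completeness of the calculus\<close>

lemma subst_tm_cong: "(\<And>i. i \<in> fv_tm t \<Longrightarrow> \<sigma> i = \<tau> i) \<Longrightarrow> subst_tm \<sigma> t = subst_tm \<tau> t"
  by (induction t) auto

lemma subst_tm_Var [simp]: "subst_tm Var t = t"
  by (induction t) (auto intro: map_idI)

lemma subst_tm_subst_tm: "subst_tm \<tau> (subst_tm \<sigma> t) = subst_tm (\<lambda>i. subst_tm \<tau> (\<sigma> i)) t"
  by (induction t) auto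

lemma under_binder_Var [simp]: "under_binder Var = Var"
  by (auto simp: under_binder_def fun_eq_iff split: nat.splits)

lemma under_binder_comp:
  "subst_tm (under_binder \<tau>) (under_binder \<sigma> i) = under_binder (\<lambda>i. subst_tm \<tau> (\<sigma> i)) i"
  by (auto simp: under_binder_def subst_tm_subst_tm split: nat.splits)

lemma subst_fm_Var [simp]: "subst_fm Var \<phi> = \<phi>"
  by (induction \<phi>) (auto intro: map_idI)

lemma subst_fm_subst_fm: "subst_fm \<tau> (subst_fm \<sigma> \<phi>) = subst_fm (\<lambda>i. subst_tm \<tau> (\<sigma> i)) \<phi>"
  by (induction \<phi> arbitrary: \<sigma> \<tau>) (auto simp: subst_tm_subst_tm under_binder_comp)

lemma subst_fm_cong: "(\<And>i. i \<in> fv_fm \<phi> \<Longrightarrow> \<sigma> i = \<tau> i) \<Longrightarrow> subst_fm \<sigma> \<phi> = subst_fm \<tau> \<phi>"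
proof (induction \<phi> arbitrary: \<sigma> \<tau>)
  case (Eq s t)
  then show ?case by (auto intro!: subst_tm_cong)
next
  case (Rel r ts)
  then show ?case by (auto intro!: subst_tm_cong)
next
  case (Imp \<phi> \<psi>)
  then show ?case
    by (metis UnCI fv_fm.simps(4) subst_fm.simps(4))
next
  case (Forall \<phi>)
  have "under_binder \<sigma> i = under_binder \<tau> i" if "i \<in> fv_fm \<phi>" for i
    using Forall.prems that by (cases i) (auto simp: under_binder_def)
  with Forall.IH[of "under_binder \<sigma>" "under_binder \<tau>"] show ?case by simp
qed auto

lemma wf_subst_tm: "wf_tm L t \<Longrightarrow> (\<And>i. wf_tm L (\<sigma> i)) \<Longrightarrow> wf_tm L (subst_tm \<sigma> t)"
  by (induction t) auto

lemma wf_subst_fm: "wf_fm L \<phi> \<Longrightarrow> (\<And>i. wf_tm L (\<sigma> i)) \<Longrightarrow> wf_fm L (subst_fm \<sigma> \<phi>)"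
proof (induction \<phi> arbitrary: \<sigma>)
  case (Forall \<phi>)
  have "wf_tm L (under_binder \<sigma> i)" for i
    using Forall.prems by (auto simp: under_binder_def intro: wf_subst_tm split: nat.splits)
  with Forall show ?case by simp
qed (auto intro: wf_subst_tm)

lemma subst_inst:
  "subst_fm \<sigma> (inst_fm \<phi> t) = inst_fm (subst_fm (under_binder \<sigma>) \<phi>) (subst_tm \<sigma> t)"
  by (auto simp: inst_fm_def subst_fm_subst_fm under_binder_def subst_tm_subst_tm
      intro!: subst_fm_cong split: nat.splits)

lemma inst_under_binder: "inst_fm (subst_fm (under_binder \<sigma>) \<phi>) t = subst_fm (case_nat t \<sigma>) \<phi>"
  by (auto simp: inst_fm_def subst_fm_subst_fm under_binder_def subst_tm_subst_tm
      intro!: subst_fm_cong split: nat.splits)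

lemma subst_lift: "subst_fm (under_binder \<sigma>) (lift_fm \<phi>) = lift_fm (subst_fm \<sigma> \<phi>)"
  by (auto simp: lift_fm_def subst_fm_subst_fm under_binder_def intro!: subst_fm_cong)

section \<open>Weakening, substitution and finiteness for derivations\<close>

lemma derives_wf: "L, \<Gamma> \<turnstile> \<phi> \<Longrightarrow> wf_fm L \<phi>"
proof (induction rule: derives.induct)
  case (ForallE \<Gamma> \<phi> t)
  then show ?case by (auto simp: inst_fm_def intro!: wf_subst_fm split: nat.splits)
next
  case (EqE \<Gamma> s t \<phi>)
  then show ?case by (auto simp: inst_fm_def intro!: wf_subst_fm split: nat.splits)
qed auto

lemma derives_mono: "L, \<Gamma> \<turnstile> \<phi> \<Longrightarrow> \<Gamma> \<subseteq> \<Delta> \<Longrightarrow> L, \<Delta> \<turnstile> \<phi>"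
proof (induction arbitrary: \<Delta> rule: derives.induct)
  case (ImpI \<phi> \<Gamma> \<psi>)
  then show ?case by (meson derives.ImpI insert_mono)
next
  case (Contr \<phi> \<Gamma>)
  then show ?case by (meson derives.Contr insert_mono)
next
  case (ForallI \<Gamma> \<phi>)
  then show ?case by (meson derives.ForallI image_mono)
qed (auto intro: derives.intros)

lemma derives_subst:
  "L, \<Gamma> \<turnstile> \<phi> \<Longrightarrow> (\<And>i. wf_tm L (\<sigma> i)) \<Longrightarrow> L, subst_fm \<sigma> ` \<Gamma> \<turnstile> subst_fm \<sigma> \<phi>"
proof (induction arbitrary: \<sigma> rule: derives.induct)
  case (Assm \<phi> \<Gamma>)
  then show ?case by (auto intro: derives.Assm wf_subst_fm)
next
  case (ImpI \<phi> \<Gamma> \<psi>)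
  then show ?case by (auto intro!: derives.ImpI wf_subst_fm)
next
  case (ImpE \<Gamma> \<phi> \<psi>)
  then show ?case by (metis derives.ImpE subst_fm.simps(4))
next
  case (Contr \<phi> \<Gamma>)
  show ?case
    by (rule derives.Contr) (use Contr in \<open>auto intro: wf_subst_fm\<close>)
next
  case (ForallI \<Gamma> \<phi>)
  have "wf_tm L (under_binder \<sigma> i)" for i
    using ForallI.prems by (auto simp: under_binder_def intro: wf_subst_tm split: nat.splits)
  from ForallI.IH[of "under_binder \<sigma>", OF this] show ?case
    by (auto intro!: derives.ForallI simp: image_image subst_lift)
next
  case (ForallE \<Gamma> \<phi> t)
  then show ?case by (auto simp: subst_inst intro!: derives.ForallE wf_subst_tm)
next
  case (EqI t \<Gamma>)
  then show ?case by (auto intro!: derives.EqI wf_subst_tm)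
next
  case (EqE \<Gamma> s t \<phi>)
  have "wf_tm L (under_binder \<sigma> i)" for i
    using EqE.prems by (auto simp: under_binder_def intro: wf_subst_tm split: nat.splits)
  then have "wf_fm L (subst_fm (under_binder \<sigma>) \<phi>)" using EqE.hyps by (auto intro: wf_subst_fm)
  moreover have "L, subst_fm \<sigma> ` \<Gamma> \<turnstile> Eq (subst_tm \<sigma> s) (subst_tm \<sigma> t)"
    using EqE.IH(1)[of \<sigma>] EqE.prems by simp
  ultimately show ?case using EqE.IH(2)[of \<sigma>] EqE.prems derives.EqE unfolding subst_inst by blast
qed

text \<open>Serves to show that the limit of the Henkin stages is consistent: a refutation uses
  formulas of one stage only.\<close>

lemma derives_finite: "L, \<Gamma> \<turnstile> \<phi> \<Longrightarrow> \<exists>\<Delta>\<subseteq>\<Gamma>. finite \<Delta> \<and> L, \<Delta> \<turnstile> \<phi>"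
proof (induction rule: derives.induct)
  case (Assm \<phi> \<Gamma>)
  then show ?case by (intro exI[of _ "{\<phi>}"]) (auto intro: derives.Assm)
next
  case (ImpI \<phi> \<Gamma> \<psi>)
  then obtain \<Delta> where *: "\<Delta> \<subseteq> insert \<phi> \<Gamma>" "finite \<Delta>" "L, \<Delta> \<turnstile> \<psi>" by blast
  have "L, insert \<phi> (\<Delta> - {\<phi>}) \<turnstile> \<psi>" by (rule derives_mono[OF *(3)]) auto
  with * show ?case using ImpI.hyps
    by (intro exI[of _ "\<Delta> - {\<phi>}"]) (auto intro: derives.ImpI)
next
  case (ImpE \<Gamma> \<phi> \<psi>)
  then obtain \<Delta> \<Delta>' where *: "\<Delta> \<subseteq> \<Gamma>" "finite \<Delta>" "L, \<Delta> \<turnstile> Imp \<phi> \<psi>" "\<Delta>' \<subseteq> \<Gamma>" "finite \<Delta>'" "L, \<Delta>' \<turnstile> \<phi>"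
    by blast
  have "L, \<Delta> \<union> \<Delta>' \<turnstile> \<psi>" using *(3,6)
    by (meson derives.ImpE derives_mono sup_ge1 sup_ge2)
  with * show ?case by (intro exI[of _ "\<Delta> \<union> \<Delta>'"]) auto
next
  case (Contr \<phi> \<Gamma>)
  then obtain \<Delta> where *: "\<Delta> \<subseteq> insert (Neg \<phi>) \<Gamma>" "finite \<Delta>" "L, \<Delta> \<turnstile> Falsum" by blast
  have "L, insert (Neg \<phi>) (\<Delta> - {Neg \<phi>}) \<turnstile> Falsum" by (rule derives_mono[OF *(3)]) auto
  with * show ?case using Contr.hyps
    by (intro exI[of _ "\<Delta> - {Neg \<phi>}"]) (auto simp: derives.Contr)
next
  case (ForallI \<Gamma> \<phi>)
  then obtain \<Delta> where *: "\<Delta> \<subseteq> lift_fm ` \<Gamma>" "finite \<Delta>" "L, \<Delta> \<turnstile> \<phi>" by blast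
  then obtain \<Delta>' where "\<Delta>' \<subseteq> \<Gamma>" "finite \<Delta>'" "\<Delta> = lift_fm ` \<Delta>'"
    by (metis finite_subset_image)
  with * show ?case by (intro exI[of _ \<Delta>']) (auto intro!: derives.ForallI)
next
  case (ForallE \<Gamma> \<phi> t)
  then show ?case by (meson derives.ForallE)
next
  case (EqI t \<Gamma>)
  then show ?case by (intro exI[of _ "{}"]) (auto intro: derives.EqI)
next
  case (EqE \<Gamma> s t \<phi>)
  then obtain \<Delta> \<Delta>' where *: "\<Delta> \<subseteq> \<Gamma>" "finite \<Delta>" "L, \<Delta> \<turnstile> Eq s t"
    "\<Delta>' \<subseteq> \<Gamma>" "finite \<Delta>'" "L, \<Delta>' \<turnstile> inst_fm \<phi> s"
    by blast
  have "L, \<Delta> \<union> \<Delta>' \<turnstile> inst_fm \<phi> t" using *(3,6) EqE.hyps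
    by (meson derives.EqE derives_mono sup_ge1 sup_ge2)
  with * show ?case by (intro exI[of _ "\<Delta> \<union> \<Delta>'"]) auto
qed

section \<open>Generalization over a fresh free variable\<close>

lemma finite_fv_tm [simp]: "finite (fv_tm t)"
  by (induction t) auto

lemma finite_fv_fm [simp]: "finite (fv_fm \<phi>)"
proof (induction \<phi>)
  case (Forall \<phi>)
  have "{i. Suc i \<in> fv_fm \<phi>} = Suc -` fv_fm \<phi>" by auto
  then show ?case using Forall by (simp add: finite_vimageI)
qed auto

text \<open>The substitution moves \<open>k\<close> to the index 0 that a quantifier is about to
  bind and shifts the other variables out of its way.\<close>

lemma subst_fresh_lift:
  assumes "k \<notin> fv_fm \<phi>"
  shows "subst_fm (\<lambda>i. if i = k then Var 0 else Var (Suc i)) \<phi> = lift_fm \<phi>"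
  using assms by (auto simp: lift_fm_def intro!: subst_fm_cong)

text \<open>Instantiation lowers \<open>Suc k\<close> to \<open>k\<close>, so an occurrence of
  \<open>Suc k\<close> would be confused with the instantiated variable.\<close>

lemma subst_fresh_inst:
  assumes "Suc k \<notin> fv_fm \<phi>"
  shows "subst_fm (\<lambda>i. if i = k then Var 0 else Var (Suc i)) (inst_fm \<phi> (Var k)) = \<phi>"
proof -
  have "subst_fm (\<lambda>i. if i = k then Var 0 else Var (Suc i)) (inst_fm \<phi> (Var k)) = subst_fm Var \<phi>"
    unfolding inst_fm_def subst_fm_subst_fm using assms
    by (intro subst_fm_cong) (auto split: nat.splits)
  then show ?thesis by simp
qed

text \<open>Renaming \<open>k\<close> to 0 brings the derivation into the shape required by
  \<open>ForallI\<close>, so a free variable can act as eigenvariable.\<close>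

lemma derives_generalize:
  assumes d: "L, \<Gamma> \<turnstile> inst_fm \<phi> (Var k)" and "\<And>\<psi>. \<psi> \<in> \<Gamma> \<Longrightarrow> k \<notin> fv_fm \<psi>" "Suc k \<notin> fv_fm \<phi>"
  shows "L, \<Gamma> \<turnstile> Forall \<phi>"
proof -
  let ?\<sigma> = "\<lambda>i. if i = k then Var 0 else Var (Suc i)"
  have "L, subst_fm ?\<sigma> ` \<Gamma> \<turnstile> subst_fm ?\<sigma> (inst_fm \<phi> (Var k))"
    by (rule derives_subst[OF d]) auto
  moreover have "subst_fm ?\<sigma> ` \<Gamma> = lift_fm ` \<Gamma>"
    using assms(2) by (intro image_cong refl subst_fresh_lift) auto
  ultimately show ?thesis
    using subst_fresh_inst[OF assms(3)] by (auto intro: derives.ForallI)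
qed

section \<open>Henkin construction with free variables as witnesses\<close>

instance tm :: (countable) countable by countable_datatype
instance fm :: (countable, countable) countable by countable_datatype

definition consistent :: "('f, 'r) language \<Rightarrow> ('f, 'r) fm set \<Rightarrow> bool" where
  "consistent L \<Gamma> \<longleftrightarrow> \<not> (L, \<Gamma> \<turnstile> Falsum)"

lemma derives_cut: "L, \<Gamma> \<turnstile> \<phi> \<Longrightarrow> L, insert \<phi> \<Gamma> \<turnstile> \<psi> \<Longrightarrow> L, \<Gamma> \<turnstile> \<psi>"
  by (meson derives.ImpE derives.ImpI derives_wf)

text \<open>If the witness led to a contradiction, \<open>Contr\<close> would derive the instance at
  \<open>k\<close>, and generalization would derive \<open>Forall \<phi>\<close>, against the
  consistency of its negation.\<close>

lemma consistent_witness: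
  assumes cons: "consistent L (insert (Neg (Forall \<phi>)) \<Gamma>)" and wf: "wf_fm L \<phi>"
    and fresh: "\<And>\<psi>. \<psi> \<in> \<Gamma> \<Longrightarrow> k \<notin> fv_fm \<psi>" "Suc k \<notin> fv_fm \<phi>"
  shows "consistent L (insert (Neg (inst_fm \<phi> (Var k))) (insert (Neg (Forall \<phi>)) \<Gamma>))"
proof -
  let ?\<Delta> = "insert (Neg (Forall \<phi>)) \<Gamma>"
  have False if "L, insert (Neg (inst_fm \<phi> (Var k))) ?\<Delta> \<turnstile> Falsum"
  proof -
    have "wf_fm L (inst_fm \<phi> (Var k))"
      using wf by (auto simp: inst_fm_def intro!: wf_subst_fm split: nat.splits)
    from derives.Contr[OF this that] have "L, ?\<Delta> \<turnstile> Forall \<phi>"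
      by (rule derives_generalize) (use fresh in auto)
    moreover have "L, ?\<Delta> \<turnstile> Neg (Forall \<phi>)" using wf by (intro derives.Assm) auto
    ultimately show False using cons by (auto simp: consistent_def intro: derives.ImpE)
  qed
  then show ?thesis by (auto simp: consistent_def)
qed

definition fresh_var :: "('f, 'r) fm set \<Rightarrow> nat" where
  "fresh_var D = (SOME k. \<forall>\<psi>\<in>D. k \<notin> fv_fm \<psi>)"

lemma fresh_var:
  assumes "finite D" "\<psi> \<in> D"
  shows "fresh_var D \<notin> fv_fm \<psi>"
proof -
  have "finite (\<Union>\<psi>\<in>D. fv_fm \<psi>)" using assms by auto
  from ex_new_if_finite[OF infinite_UNIV_nat this]
  have "\<exists>k. \<forall>\<psi>\<in>D. k \<notin> fv_fm \<psi>" by auto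
  from someI_ex[OF this] assms show ?thesis unfolding fresh_var_def by auto
qed

text \<open>Freshness for \<open>Forall \<chi>\<close> keeps the successor of the chosen index out
  of the free indices of \<open>\<chi>\<close>.\<close>

fun witnesses :: "('f, 'r) fm set \<Rightarrow> ('f, 'r) fm \<Rightarrow> ('f, 'r) fm set" where
  "witnesses D (Imp (Forall \<chi>) Falsum) = {Neg (inst_fm \<chi> (Var (fresh_var (insert (Forall \<chi>) D))))}"
| "witnesses D _ = {}"

text \<open>As \<open>T\<close> consists of sentences and only finitely many formulas are added to it at each stage,
  unused free variables are always available as Henkin constants.\<close>

primrec henkin :: "('f::countable, 'r::countable) language \<Rightarrow> ('f, 'r) fm set \<Rightarrow> ('f, 'r) fm
    \<Rightarrow> nat \<Rightarrow> ('f, 'r) fm set" where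
  "henkin L T \<alpha> 0 = {\<alpha>}"
| "henkin L T \<alpha> (Suc n) = (let D = henkin L T \<alpha> n; \<psi> = from_nat n in
     if wf_fm L \<psi> \<and> consistent L (insert \<psi> (T \<union> D)) then insert \<psi> (D \<union> witnesses D \<psi>) else D)"

lemma finite_witnesses [simp]: "finite (witnesses D \<psi>)"
  by (induction D \<psi> rule: witnesses.induct) auto

lemma finite_henkin: "finite (henkin L T \<alpha> n)"
  by (induction n) (auto simp: Let_def)

lemma henkin_mono: "m \<le> n \<Longrightarrow> henkin L T \<alpha> m \<subseteq> henkin L T \<alpha> n"
  by (rule lift_Suc_mono_le[of "henkin L T \<alpha>"]) (auto simp: Let_def)

lemma consistent_witnesses:
  assumes T: "\<And>\<psi>. \<psi> \<in> T \<Longrightarrow> sentence L \<psi>" and "finite D" and wf: "wf_fm L \<psi>"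
    and cons: "consistent L (insert \<psi> (T \<union> D))"
  shows "consistent L (T \<union> insert \<psi> (D \<union> witnesses D \<psi>))"
proof (cases "\<exists>\<chi>. \<psi> = Neg (Forall \<chi>)")
  case True
  then obtain \<chi> where \<psi>: "\<psi> = Neg (Forall \<chi>)" by blast
  let ?k = "fresh_var (insert (Forall \<chi>) D)"
  have "consistent L (insert (Neg (inst_fm \<chi> (Var ?k))) (insert (Neg (Forall \<chi>)) (T \<union> D)))"
  proof (rule consistent_witness)
    show "?k \<notin> fv_fm \<phi>" if "\<phi> \<in> T \<union> D" for \<phi>
      using that T[of \<phi>] fresh_var[of "insert (Forall \<chi>) D" \<phi>] \<open>finite D\<close>
      by (auto simp: sentence_def)
    show "Suc ?k \<notin> fv_fm \<chi>"
      using fresh_var[of "insert (Forall \<chi>) D" "Forall \<chi>"] \<open>finite D\<close> by auto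
  qed (use cons wf \<psi> in auto)
  then show ?thesis using \<psi> by (simp add: insert_commute)
next
  case False
  then have "witnesses D \<psi> = {}" by (induction D \<psi> rule: witnesses.induct) auto
  with cons show ?thesis by simp
qed

lemma consistent_henkin:
  assumes "\<And>\<psi>. \<psi> \<in> T \<Longrightarrow> sentence L \<psi>" "consistent L (insert \<alpha> T)"
  shows "consistent L (T \<union> henkin L T \<alpha> n)"
proof (induction n)
  case (Suc n)
  then show ?case
    using consistent_witnesses[where \<psi> = "from_nat n", OF assms(1) finite_henkin[of L T \<alpha> n]]
    by (auto simp: Let_def)
qed (use assms in simp)

text \<open>Variables serve as witnesses, so the language is not enlarged; maximality makes the set
  deductively closed.\<close>

locale henkin_set =
  fixes L :: "('f, 'r) language" and H :: "('f, 'r) fm set"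
  assumes cons: "consistent L H"
    and wf: "\<phi> \<in> H \<Longrightarrow> wf_fm L \<phi>"
    and maximal: "wf_fm L \<phi> \<Longrightarrow> consistent L (insert \<phi> H) \<Longrightarrow> \<phi> \<in> H"
    and witness: "Neg (Forall \<phi>) \<in> H \<Longrightarrow> \<exists>k. Neg (inst_fm \<phi> (Var k)) \<in> H"

lemma henkin_set_exists:
  fixes L :: "('f::countable, 'r::countable) language"
  assumes T: "\<And>\<psi>. \<psi> \<in> T \<Longrightarrow> sentence L \<psi>" and cons: "consistent L (insert \<alpha> T)"
    and "wf_fm L \<alpha>"
  shows "\<exists>H. henkin_set L H \<and> insert \<alpha> T \<subseteq> H"
proof (intro exI conjI)
  let ?G = "\<lambda>n. T \<union> henkin L T \<alpha> n"
  let ?H = "\<Union>n. ?G n"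
  have fin: "\<exists>n. D \<subseteq> ?G n" if "finite D" "D \<subseteq> ?H" for D
    using that
  proof (induction D rule: finite_induct)
    case (insert \<phi> D)
    then obtain m n where "D \<subseteq> ?G m" "\<phi> \<in> ?G n" by auto
    then have "insert \<phi> D \<subseteq> ?G (max m n)"
      using henkin_mono[of m "max m n" L T \<alpha>] henkin_mono[of n "max m n" L T \<alpha>] by auto
    then show ?case by blast
  qed auto
  have wfH: "wf_fm L \<phi>" if "\<phi> \<in> ?H" for \<phi>
  proof -
    have "wf_fm L \<phi>" if "\<phi> \<in> henkin L T \<alpha> n" for n
      using that
    proof (induction n)
      case (Suc n)
      have *: "wf_fm L \<phi>" if "wf_fm L \<psi>" "\<phi> \<in> witnesses D \<psi>" for D \<psi>
        using that by (induction D \<psi> rule: witnesses.induct)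
          (auto simp: inst_fm_def intro!: wf_subst_fm split: nat.splits)
      show ?case using Suc * by (auto simp: Let_def split: if_splits)
    qed (use \<open>wf_fm L \<alpha>\<close> in simp)
    with that T show ?thesis by (auto simp: sentence_def)
  qed
  \<comment> \<open>A formula is examined at the stage given by its number. What is consistent with
    the limit is consistent with that stage, so it is added there together with its witness.\<close>
  have step: "\<phi> \<in> ?H \<and> witnesses (henkin L T \<alpha> (to_nat \<phi>)) \<phi> \<subseteq> ?H"
    if "wf_fm L \<phi>" "consistent L (insert \<phi> ?H)" for \<phi>
  proof -
    have "consistent L (insert \<phi> (?G (to_nat \<phi>)))"
      using that(2) unfolding consistent_def
      by (elim contrapos_nn) (erule derives_mono, auto)
    then have "insert \<phi> (witnesses (henkin L T \<alpha> (to_nat \<phi>)) \<phi>) \<subseteq> henkin L T \<alpha> (Suc (to_nat \<phi>))"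
      using that(1) by (auto simp: Let_def)
    then show ?thesis by blast
  qed
  show "henkin_set L ?H"
  proof
    show consH: "consistent L ?H"
      unfolding consistent_def
    proof
      assume "L, ?H \<turnstile> Falsum"
      then obtain D where D: "D \<subseteq> ?H" "finite D" "L, D \<turnstile> Falsum" using derives_finite by meson
      then obtain n where "D \<subseteq> ?G n" using fin by blast
      with D consistent_henkin[OF T cons, of n] show False
        using derives_mono by (fastforce simp: consistent_def)
    qed
    show "\<exists>k. Neg (inst_fm \<phi> (Var k)) \<in> ?H" if "Neg (Forall \<phi>) \<in> ?H" for \<phi>
    proof -
      have "consistent L (insert (Neg (Forall \<phi>)) ?H)"
        using that consH by (simp add: insert_absorb)
      from step[OF wfH[OF that] this] show ?thesis by auto
    qed
  qed (use wfH step in auto)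
  show "insert \<alpha> T \<subseteq> ?H" by (auto intro!: exI[of _ 0])
qed

section \<open>Tarskian semantics over an explicit universe\<close>

primrec tval :: "('f \<Rightarrow> 'a list \<Rightarrow> 'a) \<Rightarrow> (nat \<Rightarrow> 'a) \<Rightarrow> 'f tm \<Rightarrow> 'a" where
  "tval F e (Var i) = e i"
| "tval F e (Fn f ts) = F f (map (tval F e) ts)"

primrec sat :: "'a set \<Rightarrow> ('f \<Rightarrow> 'a list \<Rightarrow> 'a) \<Rightarrow> ('r \<Rightarrow> 'a list \<Rightarrow> bool) \<Rightarrow> (nat \<Rightarrow> 'a)
    \<Rightarrow> ('f, 'r) fm \<Rightarrow> bool" where
  "sat U F R e Falsum \<longleftrightarrow> False"
| "sat U F R e (Eq s t) \<longleftrightarrow> tval F e s = tval F e t"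
| "sat U F R e (Rel r ts) \<longleftrightarrow> R r (map (tval F e) ts)"
| "sat U F R e (Imp \<phi> \<psi>) \<longleftrightarrow> (sat U F R e \<phi> \<longrightarrow> sat U F R e \<psi>)"
| "sat U F R e (Forall \<phi>) \<longleftrightarrow> (\<forall>x\<in>U. sat U F R (case_nat x e) \<phi>)"

section \<open>The term model of a Henkin set\<close>

context henkin_set
begin

lemma derives_iff: "L, H \<turnstile> \<phi> \<longleftrightarrow> \<phi> \<in> H"
proof
  assume d: "L, H \<turnstile> \<phi>"
  then have "consistent L (insert \<phi> H)"
    using cons derives_cut by (auto simp: consistent_def)
  with d show "\<phi> \<in> H" by (auto intro: maximal derives_wf)
qed (auto intro: derives.Assm wf)

lemma Falsum_notin: "Falsum \<notin> H"
  using cons derives_iff by (auto simp: consistent_def)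

lemma Neg_iff: "wf_fm L \<phi> \<Longrightarrow> Neg \<phi> \<in> H \<longleftrightarrow> \<phi> \<notin> H"
proof
  assume wf: "wf_fm L \<phi>" and "\<phi> \<notin> H"
  then have "L, insert \<phi> H \<turnstile> Falsum" using maximal by (auto simp: consistent_def)
  with wf show "Neg \<phi> \<in> H" by (auto simp flip: derives_iff intro: derives.ImpI)
next
  assume "Neg \<phi> \<in> H"
  then show "\<phi> \<notin> H" using Falsum_notin by (meson derives.ImpE derives_iff)
qed

lemma Imp_iff:
  assumes "wf_fm L \<phi>" "wf_fm L \<psi>"
  shows "Imp \<phi> \<psi> \<in> H \<longleftrightarrow> (\<phi> \<in> H \<longrightarrow> \<psi> \<in> H)"
proof
  assume *: "\<phi> \<in> H \<longrightarrow> \<psi> \<in> H"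
  have "L, insert \<phi> H \<turnstile> \<psi>"
  proof (cases "\<phi> \<in> H")
    case True
    with * have "L, H \<turnstile> \<psi>" by (simp add: derives_iff)
    then show ?thesis by (rule derives_mono) auto
  next
    case False
    then have "L, insert \<phi> H \<turnstile> Falsum" using maximal assms by (auto simp: consistent_def)
    then have "L, insert (Neg \<psi>) (insert \<phi> H) \<turnstile> Falsum" by (rule derives_mono) auto
    with assms(2) show ?thesis by (rule derives.Contr)
  qed
  with assms show "Imp \<phi> \<psi> \<in> H" by (auto simp flip: derives_iff intro: derives.ImpI)
qed (meson derives.ImpE derives_iff)

lemma Forall_iff:
  assumes "wf_fm L \<phi>"
  shows "Forall \<phi> \<in> H \<longleftrightarrow> (\<forall>t. wf_tm L t \<longrightarrow> inst_fm \<phi> t \<in> H)"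
proof
  assume *: "\<forall>t. wf_tm L t \<longrightarrow> inst_fm \<phi> t \<in> H"
  show "Forall \<phi> \<in> H"
  proof (rule ccontr)
    assume "Forall \<phi> \<notin> H"
    then have "Neg (Forall \<phi>) \<in> H" using Neg_iff[of "Forall \<phi>"] assms by simp
    then obtain k where k: "Neg (inst_fm \<phi> (Var k)) \<in> H" using witness by blast
    then have "inst_fm \<phi> (Var k) \<notin> H" using wf[OF k] Neg_iff by simp
    with * show False by auto
  qed
qed (meson derives.ForallE derives_iff)

lemma Eq_refl: "wf_tm L t \<Longrightarrow> Eq t t \<in> H"
  by (auto simp flip: derives_iff intro: derives.EqI)

lemma Eq_replace: "Eq s t \<in> H \<Longrightarrow> wf_fm L \<phi> \<Longrightarrow> inst_fm \<phi> s \<in> H \<Longrightarrow> inst_fm \<phi> t \<in> H"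
  by (meson derives.EqE derives_iff)

lemma inst_shift [simp]: "subst_tm (case_nat t Var) (subst_tm (\<lambda>j. Var (Suc j)) s) = s"
  by (simp add: subst_tm_subst_tm)

lemma map_inst_shift [simp]:
  "map (subst_tm (case_nat t Var) \<circ> subst_tm (\<lambda>j. Var (Suc j))) ts = ts"
  by (induction ts) auto

lemma wf_shift [simp]: "wf_tm L t \<Longrightarrow> wf_tm L (subst_tm (\<lambda>j. Var (Suc j)) t)"
  by (rule wf_subst_tm) auto

text \<open>\<open>EqE\<close> rewrites only index 0, so the copy of \<open>s\<close> that has to
  survive is shifted beyond it.\<close>

lemma Eq_sym: "Eq s t \<in> H \<Longrightarrow> Eq t s \<in> H"
  using Eq_replace[of s t "Eq (Var 0) (subst_tm (\<lambda>j. Var (Suc j)) s)"] wf[of "Eq s t"] Eq_refl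
  by (simp add: inst_fm_def)

lemma Eq_trans: "Eq s t \<in> H \<Longrightarrow> Eq t u \<in> H \<Longrightarrow> Eq s u \<in> H"
  using Eq_replace[of t u "Eq (subst_tm (\<lambda>j. Var (Suc j)) s) (Var 0)"] wf[of "Eq s t"]
  by (simp add: inst_fm_def)

text \<open>Arguments are replaced one at a time from the left; \<open>us\<close> collects those
  already replaced.\<close>

lemma Rel_cong:
  assumes "list_all2 (\<lambda>s t. Eq s t \<in> H) ss ts" "Rel r (us @ ss) \<in> H"
  shows "Rel r (us @ ts) \<in> H"
  using assms
proof (induction arbitrary: us rule: list_all2_induct)
  case (Cons s ss t ts)
  let ?up = "subst_tm (\<lambda>j. Var (Suc j))"
  have "inst_fm (Rel r (map ?up us @ Var 0 # map ?up ss)) t \<in> H"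
    by (rule Eq_replace[OF Cons.hyps(1)])
      (use Cons.prems wf[OF Cons.prems] in \<open>auto simp: inst_fm_def\<close>)
  then have "Rel r ((us @ [t]) @ ss) \<in> H" by (simp add: inst_fm_def)
  from Cons.IH[OF this] show ?case by simp
qed simp

lemma Fn_cong:
  assumes "list_all2 (\<lambda>s t. Eq s t \<in> H) ss ts" "wf_tm L (Fn f (us @ ss))"
  shows "Eq (Fn f (us @ ss)) (Fn f (us @ ts)) \<in> H"
  using assms
proof (induction arbitrary: us rule: list_all2_induct)
  case Nil
  then show ?case by (simp add: Eq_refl del: wf_tm.simps)
next
  case (Cons s ss t ts)
  let ?up = "subst_tm (\<lambda>j. Var (Suc j))"
  have t: "wf_tm L t" using wf[OF Cons.hyps(1)] by simp
  \<comment> \<open>Starting from reflexivity, the left side is shifted as a whole, so that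
    \<open>EqE\<close> changes a single argument on the right.\<close>
  have "inst_fm (Eq (?up (Fn f (us @ s # ss))) (Fn f (map ?up us @ Var 0 # map ?up ss))) t \<in> H"
    by (rule Eq_replace[OF Cons.hyps(1)])
      (use Cons.prems Eq_refl[OF Cons.prems] in \<open>auto simp: inst_fm_def subst_tm_subst_tm\<close>)
  then have "Eq (Fn f (us @ s # ss)) (Fn f ((us @ [t]) @ ss)) \<in> H"
    by (simp add: inst_fm_def)
  moreover have "Eq (Fn f ((us @ [t]) @ ss)) (Fn f ((us @ [t]) @ ts)) \<in> H"
    using Cons.prems t by (intro Cons.IH) auto
  ultimately show ?case using Eq_trans by auto
qed

text \<open>The model is the quotient of the terms by equality in \<open>H\<close>. Symbols are
  evaluated at chosen representatives; the congruence lemmas make the choice immaterial.\<close>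

definition cls :: "'f tm \<Rightarrow> 'f tm set" where "cls t = {s. Eq t s \<in> H}"
definition rep :: "'f tm set \<Rightarrow> 'f tm" where "rep c = (SOME t. t \<in> c)"
definition univ :: "'f tm set set" where "univ = cls ` {t. wf_tm L t}"
definition fun_int :: "'f \<Rightarrow> 'f tm set list \<Rightarrow> 'f tm set" where
  "fun_int f cs = cls (Fn f (map rep cs))"
definition rel_int :: "'r \<Rightarrow> 'f tm set list \<Rightarrow> bool" where
  "rel_int r cs \<longleftrightarrow> Rel r (map rep cs) \<in> H"

lemma Eq_rep: "wf_tm L t \<Longrightarrow> Eq t (rep (cls t)) \<in> H"
  unfolding rep_def by (rule someI2[of _ t]) (auto simp: cls_def Eq_refl)

lemma cls_eq_iff: "wf_tm L s \<Longrightarrow> cls s = cls t \<longleftrightarrow> Eq s t \<in> H"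
  unfolding cls_def set_eq_iff mem_Collect_eq by (meson Eq_refl Eq_sym Eq_trans)

lemma list_all2_rep:
  assumes "\<forall>t\<in>set ts. wf_tm L t"
  shows "list_all2 (\<lambda>s t. Eq s t \<in> H) ts (map (rep \<circ> cls) ts)"
  using assms by (auto simp: list_all2_conv_all_nth Eq_rep)

lemma fun_int_cls:
  assumes "wf_tm L (Fn f ts)"
  shows "fun_int f (map cls ts) = cls (Fn f ts)"
proof -
  have "Eq (Fn f ([] @ ts)) (Fn f ([] @ map (rep \<circ> cls) ts)) \<in> H"
    using assms by (intro Fn_cong list_all2_rep) auto
  then have "cls (Fn f ts) = cls (Fn f (map (rep \<circ> cls) ts))"
    unfolding cls_eq_iff[OF assms] by simp
  then show ?thesis by (simp add: fun_int_def)
qed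

lemma rel_int_cls:
  assumes "\<forall>t\<in>set ts. wf_tm L t"
  shows "rel_int r (map cls ts) \<longleftrightarrow> Rel r ts \<in> H"
proof -
  have *: "list_all2 (\<lambda>s t. Eq s t \<in> H) ts (map (rep \<circ> cls) ts)"
    using assms by (rule list_all2_rep)
  then have **: "list_all2 (\<lambda>s t. Eq s t \<in> H) (map (rep \<circ> cls) ts) ts"
    by (auto simp: list_all2_conv_all_nth Eq_sym)
  show ?thesis
    using Rel_cong[OF *, of r "[]"] Rel_cong[OF **, of r "[]"] by (auto simp: rel_int_def)
qed

lemma fun_int_closed:
  assumes "length cs = fun_arity L f" "set cs \<subseteq> univ"
  shows "fun_int f cs \<in> univ"
proof -
  have "\<forall>c\<in>set cs. wf_tm L (rep c)"
    using assms Eq_rep wf by (fastforce simp: univ_def)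
  with assms show ?thesis by (auto simp: fun_int_def univ_def)
qed

lemma tval_cls:
  assumes "\<And>i. wf_tm L (\<sigma> i)" "wf_tm L t"
  shows "tval fun_int (\<lambda>i. cls (\<sigma> i)) t = cls (subst_tm \<sigma> t)"
  using assms(2)
proof (induction t)
  case (Fn f ts)
  then have "map (tval fun_int (\<lambda>i. cls (\<sigma> i))) ts = map cls (map (subst_tm \<sigma>) ts)" by auto
  moreover have "wf_tm L (Fn f (map (subst_tm \<sigma>) ts))"
    using Fn.prems assms(1) by (auto intro: wf_subst_tm)
  ultimately show ?case using fun_int_cls by (simp only: tval.simps subst_tm.simps)
qed simp

text \<open>The truth lemma. It is stated for all substitutions because the quantifier case extends
  \<open>\<sigma>\<close> by an arbitrary term, every element of the universe being the class of a
  term.\<close>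

lemma truth:
  assumes "\<And>i. wf_tm L (\<sigma> i)" "wf_fm L \<phi>"
  shows "sat univ fun_int rel_int (\<lambda>i. cls (\<sigma> i)) \<phi> \<longleftrightarrow> subst_fm \<sigma> \<phi> \<in> H"
  using assms
proof (induction \<phi> arbitrary: \<sigma>)
  case Falsum
  then show ?case using Falsum_notin by simp
next
  case (Eq s t)
  then show ?case by (auto simp: tval_cls cls_eq_iff wf_subst_tm)
next
  case (Rel r ts)
  then have "map (tval fun_int (\<lambda>i. cls (\<sigma> i))) ts = map cls (map (subst_tm \<sigma>) ts)"
    by (auto simp: tval_cls)
  moreover have "\<forall>t\<in>set (map (subst_tm \<sigma>) ts). wf_tm L t"
    using Rel.prems by (auto intro: wf_subst_tm)
  ultimately show ?case using rel_int_cls by (simp only: sat.simps subst_fm.simps)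
next
  case (Imp \<phi> \<psi>)
  then show ?case by (auto simp: Imp_iff wf_subst_fm)
next
  case (Forall \<phi>)
  have "wf_tm L (under_binder \<sigma> i)" for i
    using Forall.prems by (auto simp: under_binder_def intro: wf_subst_tm split: nat.splits)
  then have wf': "wf_fm L (subst_fm (under_binder \<sigma>) \<phi>)"
    using Forall.prems by (auto intro: wf_subst_fm)
  have "sat univ fun_int rel_int (case_nat (cls t) (\<lambda>i. cls (\<sigma> i))) \<phi>
      \<longleftrightarrow> inst_fm (subst_fm (under_binder \<sigma>) \<phi>) t \<in> H" if "wf_tm L t" for t
  proof -
    have "case_nat (cls t) (\<lambda>i. cls (\<sigma> i)) = (\<lambda>i. cls (case_nat t \<sigma> i))"
      by (auto split: nat.splits)
    moreover have "wf_tm L (case_nat t \<sigma> i)" for i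
      using that Forall.prems by (auto split: nat.splits)
    ultimately show ?thesis using Forall by (simp add: inst_under_binder)
  qed
  then show ?case using Forall_iff[OF wf'] by (auto simp: univ_def)
qed

end

text \<open>An unprovable formula has its negation in some Henkin set containing \<open>T\<close>,
  whose term model refutes it. Models whose elements are sets of terms therefore suffice, and
  validity is required over this one type only.\<close>

theorem completeness:
  fixes L :: "('f::countable, 'r::countable) language"
  assumes T: "\<And>\<psi>. \<psi> \<in> T \<Longrightarrow> sentence L \<psi>" and "wf_fm L \<phi>"
    and valid: "\<And>(U :: 'f tm set set) F R e.
      \<lbrakk>\<And>f xs. length xs = fun_arity L f \<Longrightarrow> set xs \<subseteq> U \<Longrightarrow> F f xs \<in> U;
      \<And>i. e i \<in> U; \<And>\<psi>. \<psi> \<in> T \<Longrightarrow> sat U F R e \<psi>\<rbrakk> \<Longrightarrow> sat U F R e \<phi>"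
  shows "L, T \<turnstile> \<phi>"
proof (rule derives.Contr)
  show "L, insert (Neg \<phi>) T \<turnstile> Falsum"
  proof (rule ccontr)
    assume "\<not> ?thesis"
    then have "consistent L (insert (Neg \<phi>) T)" by (simp add: consistent_def)
    from henkin_set_exists[OF T this] \<open>wf_fm L \<phi>\<close> obtain H where
      H: "henkin_set L H" and sub: "insert (Neg \<phi>) T \<subseteq> H" by auto
    interpret henkin_set L H by (fact H)
    \<comment> \<open>Each free variable is assigned its own class, so truth becomes membership in
      \<open>H\<close>.\<close>
    have truth': "sat univ fun_int rel_int (\<lambda>i. cls (Var i)) \<psi> \<longleftrightarrow> \<psi> \<in> H" if "wf_fm L \<psi>" for \<psi>
      using truth[of Var \<psi>] that by simp
    have "sat univ fun_int rel_int (\<lambda>i. cls (Var i)) \<phi>"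
    proof (rule valid)
      show "fun_int f xs \<in> univ" if "length xs = fun_arity L f" "set xs \<subseteq> univ" for f xs
        using that by (rule fun_int_closed)
      show "cls (Var i) \<in> univ" for i by (auto simp: univ_def)
      show "sat univ fun_int rel_int (\<lambda>i. cls (Var i)) \<psi>" if "\<psi> \<in> T" for \<psi>
        using that sub T truth' by (auto simp: sentence_def)
    qed
    then show False using truth'[OF \<open>wf_fm L \<phi>\<close>] Neg_iff[OF \<open>wf_fm L \<phi>\<close>] sub by simp
  qed
qed fact

section \<open>Words coding trees\<close>

abbreviation twos :: "nat \<Rightarrow> digit list" where "twos k \<equiv> replicate k Two"

lemma set_twos [simp]: "set (twos k) \<subseteq> {Two}"
  by auto

lemma twos_eqI: "set t \<subseteq> {Two} \<Longrightarrow> length t = k \<Longrightarrow> t = twos k"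
  by (metis replicate_length_same singletonD subsetD)

definition marker :: "nat \<Rightarrow> digit list" where "marker k = One # twos k @ [One]"

definition pair :: "digit list \<Rightarrow> digit list \<Rightarrow> digit list" where
  "pair u v = (let p = marker (Suc (length (u @ v))) in p @ u @ p @ v @ p)"

primrec code :: "tree \<Rightarrow> digit list" where
  "code Zero = []"
| "code (Br s t) = pair (code s) (code t)"

lemma length_marker [simp]: "length (marker k) = k + 2"
  by (simp add: marker_def)

text \<open>The total length determines that of \<open>u @ v\<close> and hence the marker.\<close>

lemma length_pair: "length (pair u v) = 4 * (length u + length v) + 9"
  by (simp add: pair_def Let_def)

lemma pair_not_Nil [simp]: "pair u v \<noteq> []" "[] \<noteq> pair u v"
  by (auto simp: pair_def Let_def marker_def)

text \<open>If \<open>u\<close> is shorter than \<open>a\<close>, then the marker after \<open>a\<close> begins inside the run of \<open>2\<close>s of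
  the marker after \<open>u\<close>, as this run is longer than \<open>a\<close>.\<close>

lemma marker_position:
  assumes "u @ marker k @ v = a @ marker k @ b" "length a < k"
  shows "length a \<le> length u"
proof (rule ccontr)
  assume *: "\<not> ?thesis"
  have "(a @ marker k @ b) ! length a = One" by (simp add: marker_def)
  moreover have "(u @ marker k @ v) ! length a = Two"
    using * assms(2) by (auto simp: marker_def nth_append nth_Cons' less_imp_diff_less)
  ultimately show False using assms(1) by simp
qed

text \<open>Equal lengths give equal markers; then \<open>marker_position\<close>, applied in both
  directions, aligns the middle markers.\<close>

lemma pair_inject [simp]: "pair u v = pair a b \<longleftrightarrow> u = a \<and> v = b"
proof
  assume *: "pair u v = pair a b"
  then have len: "length u + length v = length a + length b"
    using length_pair by (metis add_right_cancel mult_left_cancel zero_neq_numeral)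
  define k where "k = Suc (length (u @ v))"
  have "u @ marker k @ v @ marker k = a @ marker k @ b @ marker k"
    using * len by (simp add: pair_def Let_def k_def)
  moreover from this have "length u = length a"
    using marker_position[of u k "v @ marker k" a "b @ marker k"]
      marker_position[of a k "b @ marker k" u "v @ marker k"] len
    by (simp add: k_def)
  ultimately show "u = a \<and> v = b" by simp
qed simp

lemma code_inject [simp]: "code s = code t \<longleftrightarrow> s = t"
proof (induction s arbitrary: t)
  case Zero
  then show ?case by (cases t) auto
next
  case (Br s1 s2)
  then show ?case by (cases t) auto
qed

section \<open>Factors of codes that are themselves pairs\<close>

lemma One_notin_twos [simp]: "One \<notin> set (twos k)"
  by auto

text \<open>A run of 2s cannot extend across a letter \<open>One\<close>.\<close>

lemma sublist_twos_split:
  assumes "sublist (twos k) (xs @ One # ys)"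
  shows "sublist (twos k) xs \<or> sublist (twos k) ys"
proof -
  consider "sublist (twos k) xs" | "sublist (twos k) (One # ys)"
    | us vs where "twos k = us @ vs" "suffix us xs" "prefix vs (One # ys)"
    using assms by (auto simp: sublist_append)
  then show ?thesis
  proof cases
    case 2
    then show ?thesis by (cases k) (auto simp: sublist_Cons_right)
  next
    case 3
    moreover have "One \<notin> set vs" using 3(1) One_notin_twos[of k] by (metis UnCI set_append)
    ultimately show ?thesis by (auto simp: prefix_Cons)
  qed simp
qed

lemma not_sublist_twos: "length xs < k \<Longrightarrow> \<not> sublist (twos k) xs"
  using sublist_length_le by fastforce

text \<open>Between the letters \<open>One\<close> of the markers lie only \<open>u\<close>,
  \<open>v\<close> and runs of length \<open>Suc (length (u @ v))\<close>, all shorter than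
  \<open>k\<close>.\<close>

lemma not_sublist_twos_pair:
  assumes "Suc (length (u @ v)) < k"
  shows "\<not> sublist (twos k) (pair u v)"
proof
  let ?j = "Suc (length (u @ v))"
  assume "sublist (twos k) (pair u v)"
  then have "sublist (twos k) (One # twos ?j @ One # u @ One # twos ?j @ One # v @ One # twos ?j @ [One])"
    by (simp add: pair_def Let_def marker_def)
  moreover have "\<not> sublist (twos k) []" "\<not> sublist (twos k) (twos ?j)"
    "\<not> sublist (twos k) u" "\<not> sublist (twos k) v"
    using assms by (intro not_sublist_twos; simp)+
  ultimately show False
    using sublist_twos_split[of k "[]"] sublist_twos_split by (metis append_Nil)
qed

text \<open>Starting and ending with \<open>One\<close>, the factor has neither end inside the run
  of 2s, and it cannot reach across the run without containing it.\<close>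

lemma sublist_avoiding_twos:
  assumes "sublist xs (ys @ twos k @ zs)" "\<not> sublist (twos k) xs"
    and "xs = One # xs'" "xs = xs'' @ [One]"
  shows "sublist xs ys \<or> sublist xs zs"
proof -
  consider "sublist xs ys" | "sublist xs (twos k)" | "sublist xs zs"
    | us vs where "xs = us @ vs" "suffix us (twos k)" "prefix vs zs"
    | us vs where "xs = us @ vs" "suffix us ys" "prefix vs (twos k @ zs)"
    using assms(1) by (auto simp: sublist_append)
  then show ?thesis
  proof cases
    case 2
    then have "One \<in> set (twos k)" using assms(3) set_mono_sublist by force
    then show ?thesis by simp
  next
    case 4
    have "us = []"
    proof (rule ccontr)
      assume "us \<noteq> []"
      then have "One \<in> set us" using 4(1) assms(3) by (cases us) auto
      then have "One \<in> set (twos k)" using 4(2) set_mono_suffix by blast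
      then show False by simp
    qed
    with 4 show ?thesis by (auto intro: prefix_imp_sublist)
  next
    case 5
    show ?thesis
    proof (cases "vs = []")
      case False
      then have One: "One \<in> set vs" using 5(1) assms(4) by (cases vs rule: rev_cases) auto
      have "prefix vs (twos k) \<or> (\<exists>ws. vs = twos k @ ws)" using 5(3) by (auto simp: prefix_append)
      moreover have "\<not> prefix vs (twos k)" using One set_mono_prefix One_notin_twos by blast
      ultimately have "sublist (twos k) xs" using 5(1) by (auto simp: sublist_append)
      with assms show ?thesis by simp
    qed (use 5 in auto)
  qed auto
qed

lemma code_One:
  "code t = [] \<or> (\<exists>w w'. code t = One # w \<and> code t = w' @ [One])"
  by (cases t) (auto simp: pair_def Let_def marker_def)

text \<open>The letter next to either outer \<open>One\<close> is again \<open>One\<close>, so a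
  factor beginning with 1 2 and ending with 2 1 can use neither of them.\<close>

lemma sublist_between_Ones:
  assumes "sublist xs (One # code t @ [One])" "xs = One # Two # xs'" "xs = xs'' @ [Two, One]"
  shows "sublist xs (code t)"
proof -
  have "\<not> prefix xs (One # code t @ [One])"
    using code_One[of t] assms(2) by auto
  with assms(1) have "sublist xs (code t @ [One])" by (auto simp: sublist_Cons_right)
  then consider "sublist xs (code t)" | "sublist xs [One]"
    | us vs where "xs = us @ vs" "suffix us (code t)" "prefix vs [One]"
    by (auto simp: sublist_append)
  then show ?thesis
  proof cases
    case 2
    then show ?thesis using sublist_length_le[OF 2] assms(2) by simp
  next
    case 3
    then consider "vs = []" | "vs = [One]" by (auto simp: prefix_Cons)
    then show ?thesis
    proof cases
      case 2
      then have "us = xs'' @ [Two]" using 3(1) assms(3) by simp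
      then have "suffix [Two] (code t)" using 3(2)
        by (meson suffix_appendD suffix_appendI suffix_order.refl suffix_order.trans)
      then show ?thesis using code_One[of t] by (auto simp: suffix_def)
    qed (use 3 in auto)
  qed simp
qed

lemma pair_ends:
  "\<exists>w w'. pair u v = One # Two # w \<and> pair u v = w' @ [Two, One]"
proof -
  have "pair u v = (marker (Suc (length (u @ v))) @ u @ marker (Suc (length (u @ v))) @ v @
      One # twos (length (u @ v))) @ [Two, One]"
    by (simp add: pair_def Let_def marker_def replicate_append_same flip: replicate_Suc)
  moreover have "\<exists>w. pair u v = One # Two # w" by (simp add: pair_def Let_def marker_def)
  ultimately show ?thesis by blast
qed

lemma sublist_pair_pair:
  assumes "sublist (pair u v) (pair (code s) (code t))"
  shows "pair u v = pair (code s) (code t) \<or> sublist (pair u v) (code s) \<or> sublist (pair u v) (code t)"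
proof -
  let ?x = "pair u v"
  define k where "k = Suc (length (code s @ code t))"
  obtain w w' where w: "?x = One # Two # w" "?x = w' @ [Two, One]" using pair_ends by meson
  have len: "length ?x \<le> length (pair (code s) (code t))" using assms by (rule sublist_length_le)
  show ?thesis
  proof (cases "length ?x = length (pair (code s) (code t))")
    case True
    with assms show ?thesis by (auto simp: sublist_def)
  next
    case False
    \<comment> \<open>A proper factor is a shorter pair, so the runs of 2s in its markers are
      shorter.\<close>
    with len have "\<not> sublist (twos k) ?x"
      by (intro not_sublist_twos_pair) (simp add: length_pair k_def)
    note avoid = sublist_avoiding_twos[OF _ this, of _ _ "Two # w" "w' @ [Two]"]
    have 1: "\<not> sublist ?x [One]"
      using sublist_length_le[of ?x "[One]"] w by auto
    \<comment> \<open>The three runs cut the word into four pieces, one of which must contain the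
      factor; the two outer pieces are single letters.\<close>
    have "pair (code s) (code t) = [One] @ twos k @ (One # code s @ [One]) @ twos k @
        (One # code t @ [One]) @ twos k @ [One]"
      by (simp add: pair_def Let_def marker_def k_def)
    then have "sublist ?x (One # code s @ [One]) \<or> sublist ?x (One # code t @ [One])"
      using assms avoid w 1 by (metis append.assoc append_Cons append_Nil)
    then show ?thesis using sublist_between_Ones w by blast
  qed
qed

text \<open>Arbitrary \<open>u\<close> and \<open>v\<close> suffice because a pair occurring in the
  code of a tree is the whole code or lies in the code of one branch. The empty factor matches
  \<open>Zero\<close>, a subterm of every tree.\<close>

lemma sublist_code_iff:
  "sublist x (code t) \<and> (x = [] \<or> (\<exists>u v. x = pair u v)) \<longleftrightarrow> x \<in> code ` set (subterms t)"
proof (intro iffI)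
  assume "sublist x (code t) \<and> (x = [] \<or> (\<exists>u v. x = pair u v))"
  then show "x \<in> code ` set (subterms t)"
  proof (induction t)
    case (Br s t)
    show ?case
    proof (cases "x = []")
      case True
      with Br show ?thesis by auto
    next
      case False
      with Br.prems obtain u v where "x = pair u v" by auto
      with Br sublist_pair_pair[of u v s t] show ?thesis by auto
    qed
  qed simp
next
  assume "x \<in> code ` set (subterms t)"
  then obtain s where s: "s \<in> set (subterms t)" "x = code s" by auto
  from s(1) have "sublist (code s) (code t)"
  proof (induction t)
    case (Br t1 t2)
    let ?p = "marker (Suc (length (code t1 @ code t2)))"
    have eq: "code (Br t1 t2) = ?p @ code t1 @ (?p @ code t2 @ ?p)"
      "code (Br t1 t2) = (?p @ code t1 @ ?p) @ code t2 @ ?p"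
      by (simp_all add: pair_def Let_def)
    have "sublist (code t1) (code (Br t1 t2))" "sublist (code t2) (code (Br t1 t2))"
      unfolding sublist_def using eq by blast+
    moreover have "s = Br t1 t2 \<or> s \<in> set (subterms t1) \<or> s \<in> set (subterms t2)"
      using Br.prems by simp
    ultimately show ?case using Br.IH sublist_order.order_trans sublist_order.order_refl by metis
  qed simp
  moreover have "x = [] \<or> (\<exists>u v. x = pair u v)" using s(2) by (cases s) auto
  ultimately show "sublist x (code t) \<and> (x = [] \<or> (\<exists>u v. x = pair u v))" using s(2) by simp
qed

text \<open>Turns addition of lengths into a comparison with the only word of the form \<open>2\<^sup>i 1 2\<^sup>j\<close>.\<close>

lemma single_One_iff:
  "w = twos i @ One # twos j \<longleftrightarrow> prefix (twos i @ [One]) w \<and> prefix (twos j @ [One]) (rev w) \<and>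
    (\<forall>n. length n \<le> length w \<longrightarrow> prefix (n @ [One]) w \<longrightarrow> n = twos i)" (is "_ \<longleftrightarrow> ?r")
proof
  assume w: "w = twos i @ One # twos j"
  have "n = twos i" if "prefix (n @ [One]) w" for n
  proof -
    have n: "n @ [One] = take (Suc (length n)) w" using that by (auto simp: prefix_def)
    have len: "length n < length w" using that by (auto simp: prefix_def)
    have "w ! length n = One" using that by (auto simp: prefix_def nth_append)
    then have "length n = i" using len unfolding w
      by (auto simp: nth_append nth_Cons' split: if_splits)
    with n show ?thesis unfolding w by simp
  qed
  then show ?r by (auto simp: w)
next
  assume r: ?r
  then obtain z where z: "w = twos i @ One # z" by (auto simp: prefix_def)
  obtain y where "rev w = twos j @ One # y" using r by (auto simp: prefix_def)
  then have "rev (rev w) = rev y @ One # twos j" by simp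
  then have y: "w = rev y @ [One] @ twos j" by simp
  then have "rev y = twos i" using r by (auto simp: prefix_def)
  with y show "w = twos i @ One # twos j" by simp
qed

section \<open>The translation\<close>

lemma tval_subst: "tval F e (subst_tm \<sigma> t) = tval F (\<lambda>i. tval F e (\<sigma> i)) t"
  by (induction t) (auto cong: map_cong simp: comp_def)

lemma sat_subst: "sat U F R e (subst_fm \<sigma> \<phi>) \<longleftrightarrow> sat U F R (\<lambda>i. tval F e (\<sigma> i)) \<phi>"
proof (induction \<phi> arbitrary: e \<sigma>)
  case (Forall \<phi>)
  have "(\<lambda>i. tval F (case_nat x e) (under_binder \<sigma> i)) = case_nat x (\<lambda>i. tval F e (\<sigma> i))" for x
    by (auto simp: under_binder_def tval_subst fun_eq_iff split: nat.splits)
  with Forall show ?case by simp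
qed (auto simp: tval_subst comp_def)

lemma sat_app_fm:
  "sat U F R e (app_fm \<phi> ts) \<longleftrightarrow> sat U F R (\<lambda>i. if i < length ts then tval F e (ts ! i) else e i) \<phi>"
  by (simp add: app_fm_def sat_subst if_distrib cong: if_cong)

lemma sat_Disj: "sat U F R e (Disj \<phi>s) \<longleftrightarrow> (\<exists>\<phi>\<in>set \<phi>s. sat U F R e \<phi>)"
  by (induction \<phi>s) (auto simp: Disj_def)

lemma tval_cong: "(\<And>i. i \<in> fv_tm t \<Longrightarrow> e i = e' i) \<Longrightarrow> tval F e t = tval F e' t"
proof (induction t)
  case (Fn f ts)
  then have "map (tval F e) ts = map (tval F e') ts" by auto
  then show ?case by (simp only: tval.simps)
qed simp

lemma sat_cong: "(\<And>i. i \<in> fv_fm \<phi> \<Longrightarrow> e i = e' i) \<Longrightarrow> sat U F R e \<phi> \<longleftrightarrow> sat U F R e' \<phi>"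
proof (induction \<phi> arbitrary: e e')
  case (Eq s t)
  then show ?case using tval_cong[of s e e' F] tval_cong[of t e e' F] by simp
next
  case (Rel r ts)
  have "map (tval F e) ts = map (tval F e') ts"
    using Rel by (auto intro: tval_cong)
  then show ?case by (simp only: sat.simps)
next
  case (Imp \<phi> \<psi>)
  then show ?case by (metis UnCI fv_fm.simps(4) sat.simps(4))
next
  case (Forall \<phi>)
  have "sat U F R (case_nat x e) \<phi> \<longleftrightarrow> sat U F R (case_nat x e') \<phi>" for x
    by (rule Forall.IH) (use Forall.prems in \<open>auto split: nat.splits\<close>)
  then show ?case by simp
qed simp

section \<open>Formulas defining concatenation, pairing and subterms\<close>

abbreviation shift :: "nat \<Rightarrow> 'f tm \<Rightarrow> 'f tm" where
  "shift n \<equiv> subst_tm (\<lambda>j. Var (j + n))"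

definition len_ex :: "nat \<Rightarrow> (vw_fun, vw_rel) fm \<Rightarrow> (vw_fun, vw_rel) fm" where
  "len_ex y \<phi> = Exists (And (Rel Len [Var 0, Var (Suc y)]) \<phi>)"

definition len_all :: "nat \<Rightarrow> (vw_fun, vw_rel) fm \<Rightarrow> (vw_fun, vw_rel) fm" where
  "len_all y \<phi> = Forall (Imp (Rel Len [Var 0, Var (Suc y)]) \<phi>)"

text \<open>Lengths are compared through the words that bound them by \<open>|\<le>|\<close>; among
  standard words only runs of 2s bound a standard word.\<close>

definition eq_len_fm :: "nat \<Rightarrow> vw_fun tm \<Rightarrow> vw_fun tm \<Rightarrow> (vw_fun, vw_rel) fm" where
  "eq_len_fm y s t = len_all y (Iff (Rel Len [shift 1 s, Var 0]) (Rel Len [shift 1 t, Var 0]))"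

definition Conj :: "('f, 'r) fm list \<Rightarrow> ('f, 'r) fm" where
  "Conj \<phi>s = foldr And \<phi>s (Neg Falsum)"

text \<open>In the formulas below, \<open>y\<close> is the index of the bound of all quantifiers.  Under the
  quantifiers of \<open>cat_fm\<close>, the indices 2, 1, 0 are the words \<open>2\<^sup>i\<close>, \<open>2\<^sup>j\<close> and \<open>2\<^sup>i 1 2\<^sup>j\<close>; under those
  of \<open>pair_fm\<close>, the indices 4, \<dots>, 0 are \<open>uv\<close>, \<open>2\<^sup>k\<close>, \<open>pu\<close>, \<open>pup\<close> and \<open>pupv\<close>.  As \<open>x |\<le>| x\<close> is refuted
  for standard \<open>x\<close> not of the form \<open>2\<^sup>m\<close>, it serves to define these words.\<close>

definition cat_fm :: "nat \<Rightarrow> vw_fun tm \<Rightarrow> vw_fun tm \<Rightarrow> vw_fun tm \<Rightarrow> (vw_fun, vw_rel) fm" where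
  "cat_fm y u v z = Conj
    [Rel Len [Fn (S One) [z], Var y],
     Rel Sub [u, z],
     Rel Sub [Fn Rv [v], Fn Rv [z]],
     len_ex y (len_ex (y + 1) (len_ex (y + 2) (Conj
       [Rel Len [Var 2, Var 2],
        eq_len_fm (y + 3) (Var 2) (shift 3 u),
        Rel Len [Var 1, Var 1],
        eq_len_fm (y + 3) (Var 1) (shift 3 v),
        eq_len_fm (y + 3) (Var 0) (Fn (S One) [shift 3 z]),
        Rel Sub [Fn (S One) [Var 2], Var 0],
        Rel Sub [Fn (S One) [Var 1], Fn Rv [Var 0]],
        len_all (y + 3) (Imp (Rel Sub [Fn (S One) [Var 0], Var 1]) (Eq (Var 0) (Var 3)))])))]"

definition pair_fm :: "nat \<Rightarrow> vw_fun tm \<Rightarrow> vw_fun tm \<Rightarrow> vw_fun tm \<Rightarrow> (vw_fun, vw_rel) fm" where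
  "pair_fm y u v z = (let p = Fn (S One) [Fn Rv [Fn (S One) [Var 3]]] in
    len_ex y (len_ex (y + 1) (len_ex (y + 2) (len_ex (y + 3) (len_ex (y + 4) (Conj
      [cat_fm (y + 5) (shift 5 u) (shift 5 v) (Var 4),
       Rel Len [Var 3, Var 3],
       eq_len_fm (y + 5) (Var 3) (Fn (S One) [Var 4]),
       cat_fm (y + 5) p (shift 5 u) (Var 2),
       cat_fm (y + 5) (Var 2) p (Var 1),
       cat_fm (y + 5) (Var 1) (shift 5 v) (Var 0),
       cat_fm (y + 5) (Var 0) p (shift 5 z)]))))))"

text \<open>Index 0 is \<open>y\<close>; in \<open>\<psi>\<close>, index 0 is a candidate strictly below \<open>y\<close> and index 1 is \<open>y\<close>.\<close>

definition minimal_fm :: "(vw_fun, vw_rel) fm \<Rightarrow> (vw_fun, vw_rel) fm" where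
  "minimal_fm \<psi> =
    And (Rel Sub [canon [], Var 0])
    (Forall (Imp (Rel Sub [Var 0, Var 1]) (Imp (Neg (Eq (Var 0) (Var 1)))
      (And (Rel Sub [Fn (S Two) [Var 0], Var 1]) (Neg \<psi>)))))"

text \<open>At standard arguments, \<open>minimal_fm\<close> keeps the bound from passing the first
  \<open>2\<^sup>m\<close> with room for their pair; the last conjunct makes it large enough, and
  the middle one excludes nonstandard values.\<close>

definition graph_fm :: "(vw_fun, vw_rel) fm" where
  "graph_fm = Exists (Conj
    [minimal_fm (len_ex 0 (pair_fm 1 (Var 3) (Var 4) (Var 0))),
     Rel Len [Var 3, Var 0],
     pair_fm 0 (Var 1) (Var 2) (Var 3)])"

definition unique_fm :: "nat \<Rightarrow> nat \<Rightarrow> nat \<Rightarrow> (vw_fun, vw_rel) fm" where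
  "unique_fm a b z =
    Forall (Iff (app_fm graph_fm [Var (Suc a), Var (Suc b), Var 0]) (Eq (Var 0) (Var (Suc z))))"

text \<open>The default value makes the axioms on existence and uniqueness hold at every element,
  standard or not.\<close>

definition tern_fm :: "(vw_fun, vw_rel) fm" where
  "tern_fm = Or (unique_fm 0 1 2) (And (Neg (Exists (unique_fm 1 2 0))) (Eq (Var 2) (canon [])))"

text \<open>A factor is a suffix of a prefix. \<open>S One\<close> in the bound leaves the extra
  letter of room that \<open>pair_fm\<close> requires.\<close>

definition subtm_fm :: "(vw_fun, vw_rel) fm" where
  "subtm_fm = Exists (Conj
    [minimal_fm (Rel Len [Fn (S One) [Var 3], Var 0]),
     Rel Len [Fn (S One) [Var 2], Var 0],
     Rel Len [Var 1, Var 0],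
     Exists (And (Rel Sub [Var 0, Var 3]) (Rel Sub [Fn Rv [Var 2], Fn Rv [Var 0]])),
     Or (Eq (Var 1) (canon [])) (len_ex 0 (len_ex 1 (pair_fm 2 (Var 1) (Var 0) (Var 3))))])"

definition wt_translation :: "(wt_fun, wt_rel, vw_fun, vw_rel) translation" where
  "wt_translation = \<lparr>dom_tr = Neg Falsum,
     fun_tr = (\<lambda>f. case f of Const t \<Rightarrow> Eq (Var 0) (canon (code t))),
     rel_tr = case_wt_rel tern_fm subtm_fm\<rparr>"

section \<open>Well-formedness and free variables of the translation\<close>

lemma wf_Conj [simp]: "wf_fm L (Conj \<phi>s) \<longleftrightarrow> (\<forall>\<phi>\<in>set \<phi>s. wf_fm L \<phi>)"
  by (induction \<phi>s) (auto simp: Conj_def)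

lemma fv_Conj [simp]: "fv_fm (Conj \<phi>s) = (\<Union>\<phi>\<in>set \<phi>s. fv_fm \<phi>)"
  by (induction \<phi>s) (auto simp: Conj_def)

lemma sat_Conj [simp]:
  "sat U F R e (Conj [])"
  "sat U F R e (Conj (\<phi> # \<phi>s)) \<longleftrightarrow> sat U F R e \<phi> \<and> sat U F R e (Conj \<phi>s)"
  by (simp_all add: Conj_def)

lemma VW_arity [simp]:
  "fun_arity VW_lang Eps = 0" "fun_arity VW_lang (S d) = 1" "fun_arity VW_lang Rv = 1"
  "rel_arity VW_lang r = 2"
  by (simp_all add: VW_lang_def)

lemma fv_tm_subst: "fv_tm (subst_tm \<sigma> t) = (\<Union>i\<in>fv_tm t. fv_tm (\<sigma> i))"
  by (induction t) auto

lemma wf_len_ex [simp]: "wf_fm VW_lang (len_ex y \<phi>) \<longleftrightarrow> wf_fm VW_lang \<phi>"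
  and wf_len_all [simp]: "wf_fm VW_lang (len_all y \<phi>) \<longleftrightarrow> wf_fm VW_lang \<phi>"
  by (simp_all add: len_ex_def len_all_def)

lemma fv_len_ex [simp]: "fv_fm (len_ex y \<phi>) = insert y {i. Suc i \<in> fv_fm \<phi>}"
  and fv_len_all [simp]: "fv_fm (len_all y \<phi>) = insert y {i. Suc i \<in> fv_fm \<phi>}"
  by (auto simp: len_ex_def len_all_def)

lemma wf_eq_len_fm: "wf_tm VW_lang s \<Longrightarrow> wf_tm VW_lang t \<Longrightarrow> wf_fm VW_lang (eq_len_fm y s t)"
  by (simp add: eq_len_fm_def wf_subst_tm)

lemma wf_cat_fm:
  "wf_tm VW_lang u \<Longrightarrow> wf_tm VW_lang v \<Longrightarrow> wf_tm VW_lang z \<Longrightarrow> wf_fm VW_lang (cat_fm y u v z)"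
  by (simp add: cat_fm_def wf_subst_tm wf_eq_len_fm)

lemma wf_pair_fm:
  "wf_tm VW_lang u \<Longrightarrow> wf_tm VW_lang v \<Longrightarrow> wf_tm VW_lang z \<Longrightarrow> wf_fm VW_lang (pair_fm y u v z)"
  by (simp add: pair_fm_def Let_def wf_subst_tm wf_eq_len_fm wf_cat_fm)

lemma fv_eq_len_fm: "fv_fm (eq_len_fm y s t) = insert y (fv_tm s \<union> fv_tm t)"
  by (auto simp: eq_len_fm_def fv_tm_subst)

lemma fv_cat_fm: "fv_fm (cat_fm y u v z) = insert y (fv_tm u \<union> fv_tm v \<union> fv_tm z)"
  by (auto simp: cat_fm_def fv_eq_len_fm fv_tm_subst)

lemma fv_pair_fm: "fv_fm (pair_fm y u v z) = insert y (fv_tm u \<union> fv_tm v \<union> fv_tm z)"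
  by (auto simp: pair_fm_def Let_def fv_eq_len_fm fv_cat_fm fv_tm_subst)

lemma wf_minimal_fm: "wf_fm VW_lang \<psi> \<Longrightarrow> wf_fm VW_lang (minimal_fm \<psi>)"
  by (simp add: minimal_fm_def)

lemma fv_minimal_fm: "fv_fm (minimal_fm \<psi>) = insert 0 {i. Suc i \<in> fv_fm \<psi>}"
  by (auto simp: minimal_fm_def)

lemma wf_graph_fm: "wf_fm VW_lang graph_fm"
  by (simp add: graph_fm_def wf_minimal_fm wf_pair_fm)

lemma fv_graph_fm: "fv_fm graph_fm \<subseteq> {0, 1, 2}"
  by (auto simp: graph_fm_def fv_minimal_fm fv_pair_fm numeral_eq_Suc)

lemma fv_fm_subst_subset: "fv_fm (subst_fm \<sigma> \<phi>) \<subseteq> (\<Union>i\<in>fv_fm \<phi>. fv_tm (\<sigma> i))"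
proof (induction \<phi> arbitrary: \<sigma>)
  case (Imp \<phi> \<psi>)
  show ?case using Imp.IH(1)[of \<sigma>] Imp.IH(2)[of \<sigma>] by auto
next
  case (Forall \<phi>)
  show ?case
  proof
    fix i assume "i \<in> fv_fm (subst_fm \<sigma> (Forall \<phi>))"
    then obtain j where "j \<in> fv_fm \<phi>" "Suc i \<in> fv_tm (under_binder \<sigma> j)"
      using Forall[of "under_binder \<sigma>"] by auto
    then show "i \<in> (\<Union>j\<in>fv_fm (Forall \<phi>). fv_tm (\<sigma> j))"
      by (cases j) (auto simp: under_binder_def fv_tm_subst)
  qed
qed (auto simp: fv_tm_subst)

lemma wf_unique_fm: "wf_fm VW_lang (unique_fm a b z)"
  by (auto simp: unique_fm_def app_fm_def nth_Cons' intro!: wf_subst_fm wf_graph_fm)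

lemma fv_unique_fm: "fv_fm (unique_fm a b z) \<subseteq> {a, b, z}"
proof -
  have "fv_fm (app_fm graph_fm [Var (Suc a), Var (Suc b), Var 0]) \<subseteq> {Suc a, Suc b, 0}"
    using fv_graph_fm unfolding app_fm_def
    by (intro order.trans[OF fv_fm_subst_subset]) (auto simp: numeral_eq_Suc)
  then show ?thesis by (auto simp: unique_fm_def)
qed

lemma fv_subtm_fm: "fv_fm subtm_fm \<subseteq> {0, 1}"
  by (auto simp: subtm_fm_def fv_minimal_fm fv_pair_fm numeral_eq_Suc)

lemma wf_translation_wt: "wf_translation WT_lang VW_lang wt_translation"
proof -
  have "wf_fm VW_lang tern_fm" "wf_fm VW_lang subtm_fm"
    by (simp_all add: tern_fm_def wf_unique_fm subtm_fm_def wf_minimal_fm wf_pair_fm)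
  moreover have "fv_fm tern_fm \<subseteq> {..<3}"
    by (auto simp: tern_fm_def dest!: subsetD[OF fv_unique_fm])
  moreover have "fv_fm subtm_fm \<subseteq> {..<2}"
    using fv_subtm_fm by auto
  ultimately show ?thesis
    by (auto simp: wf_translation_def wt_translation_def WT_lang_def split: wt_fun.splits wt_rel.splits)
qed

section \<open>Models of the theory of words\<close>

text \<open>Quantifiers bounded by \<open>2\<^sup>m\<close> cannot tell apart lengths greater than \<open>m\<close>.\<close>

definition eq_upto :: "nat \<Rightarrow> nat \<Rightarrow> nat \<Rightarrow> bool" where
  "eq_upto m i j \<longleftrightarrow> min i (Suc m) = min j (Suc m)"

locale vw_model =
  fixes U :: "'a set" and F :: "vw_fun \<Rightarrow> 'a list \<Rightarrow> 'a" and R :: "vw_rel \<Rightarrow> 'a list \<Rightarrow> bool"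
    and e0 :: "nat \<Rightarrow> 'a"
  assumes closed: "length xs = fun_arity VW_lang f \<Longrightarrow> set xs \<subseteq> U \<Longrightarrow> F f xs \<in> U"
    and env: "e0 i \<in> U"
    and axiom: "\<phi> \<in> VW_plus \<Longrightarrow> sat U F R e0 \<phi>"
begin

section \<open>The standard words in a model\<close>

definition word :: "digit list \<Rightarrow> 'a" where
  "word w = foldl (\<lambda>a d. F (S d) [a]) (F Eps []) w"

lemma word_snoc: "word (w @ [d]) = F (S d) [word w]"
  by (simp add: word_def)

lemma tval_canon [simp]: "tval F e (canon w) = word w"
  by (induction w rule: rev_induct) (auto simp: canon_def word_def)

lemma succ_word [simp]: "F (S d) [word w] = word (w @ [d])"
  by (simp add: word_snoc)

lemma word_in [simp]: "word w \<in> U"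
  by (induction w rule: rev_induct)
    (auto simp: word_snoc simp del: succ_word intro!: closed, simp add: word_def closed)

lemma word_inject [simp]: "word s = word t \<longleftrightarrow> s = t"
  using axiom[OF VW1, of s t] by auto

lemma rev_word [simp]: "F Rv [word t] = word (rev t)"
  using axiom[OF VW8, of t] by simp

text \<open>Peeling off letters by VW5 down to VW3 and VW4 leaves only standard prefixes, whatever
  the element \<open>x\<close>.\<close>

lemma sub_word_iff:
  assumes "x \<in> U"
  shows "R Sub [x, word t] \<longleftrightarrow> (\<exists>s. prefix s t \<and> x = word s)"
proof (induction t rule: rev_induct)
  case Nil
  show ?case using axiom[OF VW3, of "[]"] axiom[OF VW4] assms by auto
next
  case (snoc d t)
  have "R Sub [x, word (t @ [d])] \<longleftrightarrow> R Sub [x, word t] \<or> x = word (t @ [d])"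
    using axiom[OF VW5, of d t] assms by auto
  with snoc show ?case by (auto simp: prefix_snoc)
qed

lemma sub_word [simp]: "R Sub [word s, word t] \<longleftrightarrow> prefix s t"
  by (auto simp: sub_word_iff)

lemma len_twos_iff:
  assumes "x \<in> U"
  shows "R Len [x, word (twos m)] \<longleftrightarrow> (\<exists>s. length s \<le> m \<and> x = word s)"
  using axiom[OF VW6, of m] assms by (auto simp: sat_Disj set_words_upto)

text \<open>VW6 settles the bounds \<open>2\<^sup>m\<close>. If a word containing 1 bounded
  anything, VW7 would force each of its nonempty prefixes to end in 2.\<close>

lemma len_word [simp]: "R Len [word s, word t] \<longleftrightarrow> set t \<subseteq> {Two} \<and> length s \<le> length t"
proof (cases "set t \<subseteq> {Two}")
  case True
  then have "t = twos (length t)" by (rule twos_eqI) simp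
  then have "R Len [word s, word t] \<longleftrightarrow> (\<exists>s'. length s' \<le> length t \<and> word s = word s')"
    using len_twos_iff[of "word s" "length t"] by (metis word_in)
  with True show ?thesis by auto
next
  case False
  have "\<not> R Len [word s, word t]"
  proof
    assume "R Len [word s, word t]"
    then have "\<forall>x\<in>U. R Sub [x, word t] \<and> x \<noteq> word [] \<longrightarrow> R Sub [word [Two], F Rv [x]]"
      using axiom[OF VW7, of t] by auto
    from bspec[OF this word_in] have *: "prefix w t \<Longrightarrow> w \<noteq> [] \<Longrightarrow> prefix [Two] (rev w)" for w
      by simp
    then have "set t \<subseteq> {Two}"
    proof (induction t rule: rev_induct)
      case (snoc d t)
      have "set t \<subseteq> {Two}" using snoc.IH snoc.prems by (meson prefix_prefix)
      moreover have "d = Two" using snoc.prems[of "t @ [d]"] by simp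
      ultimately show ?case by simp
    qed simp
    with False show False by simp
  qed
  with False show ?thesis by simp
qed

section \<open>Meaning of the formulas at standard words\<close>

lemma sat_len_ex:
  assumes "e y = word (twos m)"
  shows "sat U F R e (len_ex y \<phi>) \<longleftrightarrow> (\<exists>s. length s \<le> m \<and> sat U F R (case_nat (word s) e) \<phi>)"
  using assms by (auto simp: len_ex_def len_twos_iff)

lemma sat_len_all:
  assumes "e y = word (twos m)"
  shows "sat U F R e (len_all y \<phi>) \<longleftrightarrow> (\<forall>s. length s \<le> m \<longrightarrow> sat U F R (case_nat (word s) e) \<phi>)"
  using assms by (auto simp: len_all_def len_twos_iff)

lemma sat_eq_len_fm:
  assumes "e y = word (twos m)" "tval F e s = word s'" "tval F e t = word t'"
  shows "sat U F R e (eq_len_fm y s t) \<longleftrightarrow> eq_upto m (length s') (length t')"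
proof -
  have "sat U F R e (eq_len_fm y s t) \<longleftrightarrow>
      (\<forall>n. length n \<le> m \<longrightarrow> set n \<subseteq> {Two} \<longrightarrow> length s' \<le> length n \<longleftrightarrow> length t' \<le> length n)"
    using assms(2,3) unfolding eq_len_fm_def sat_len_all[where e = e and y = y, OF assms(1)]
    by (auto simp: tval_subst)
  also have "\<dots> \<longleftrightarrow> eq_upto m (length s') (length t')"
    unfolding eq_upto_def
  proof
    assume *: "\<forall>n. length n \<le> m \<longrightarrow> set n \<subseteq> {Two} \<longrightarrow> length s' \<le> length n \<longleftrightarrow> length t' \<le> length n"
    show "min (length s') (Suc m) = min (length t') (Suc m)"
      \<comment> \<open>A length up to \<open>m\<close> is tested by the run of 2s of that length;
        longer runs are out of range.\<close>
      using *[rule_format, of "twos (length s')"] *[rule_format, of "twos (length t')"]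
      by simp linarith
  qed (auto simp: min_def split: if_splits)
  finally show ?thesis .
qed

lemma sat_cat_fm:
  assumes "e y = word (twos m)" "tval F e u = word u'" "tval F e v = word v'" "tval F e z = word z'"
  shows "sat U F R e (cat_fm y u v z) \<longleftrightarrow> z' = u' @ v' \<and> length z' < m"
proof -
  have "sat U F R e (cat_fm y u v z) \<longleftrightarrow> Suc (length z') \<le> m \<and> prefix u' z' \<and> prefix (rev v') (rev z') \<and>
    (\<exists>i. length i \<le> m \<and> (\<exists>j. length j \<le> m \<and> (\<exists>w. length w \<le> m \<and>
      set i \<subseteq> {Two} \<and> eq_upto m (length i) (length u') \<and> set j \<subseteq> {Two} \<and> eq_upto m (length j) (length v') \<and>
      eq_upto m (length w) (length (z' @ [One])) \<and> prefix (i @ [One]) w \<and> prefix (j @ [One]) (rev w) \<and>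
      (\<forall>n. length n \<le> m \<longrightarrow> prefix (n @ [One]) w \<longrightarrow> n = i))))" (is "_ \<longleftrightarrow> ?r")
    using assms
    by (simp add: cat_fm_def sat_len_ex[where m = m],
        simp add: sat_len_all[where m = m] numeral_eq_Suc,
        simp add: sat_eq_len_fm[where m = m] tval_subst)
  also have "\<dots> \<longleftrightarrow> z' = u' @ v' \<and> length z' < m"
  proof
    assume ?r
    then obtain i j w where z: "Suc (length z') \<le> m" "prefix u' z'" "prefix (rev v') (rev z')"
      and w: "length w \<le> m" "eq_upto m (length w) (length (z' @ [One]))"
        "prefix (i @ [One]) w" "prefix (j @ [One]) (rev w)"
        "\<forall>n. length n \<le> m \<longrightarrow> prefix (n @ [One]) w \<longrightarrow> n = i"
      and i: "length i \<le> m" "set i \<subseteq> {Two}" "eq_upto m (length i) (length u')"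
      and j: "length j \<le> m" "set j \<subseteq> {Two}" "eq_upto m (length j) (length v')"
      by blast
    \<comment> \<open>These bounds turn the truncated comparisons into equalities of
      lengths.\<close>
    have "length u' \<le> m" "length v' \<le> m"
      using z(1) prefix_length_le[OF z(2)] prefix_length_le[OF z(3)] by auto
    with i j have ij: "i = twos (length u')" "j = twos (length v')"
      by (auto simp: eq_upto_def intro!: twos_eqI)
    have "length w = Suc (length z')" using w(1,2) z(1) by (simp add: eq_upto_def)
    moreover have "w = i @ One # j"
      using single_One_iff[of w "length u'" "length v'"] w ij by (meson order.trans)
    ultimately have "length z' = length u' + length v'" by (simp add: ij)
    \<comment> \<open>A prefix and a suffix whose lengths add up to that of \<open>z'\<close> meet
      without gap or overlap.\<close>
    with z(2,3) show "z' = u' @ v' \<and> length z' < m"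
      using z(1) by (auto simp: suffix_to_prefix[symmetric] suffix_def elim!: prefixE)
  next
    assume z: "z' = u' @ v' \<and> length z' < m"
    let ?i = "twos (length u')" and ?j = "twos (length v')"
    let ?w = "?i @ One # ?j"
    have w: "prefix (?i @ [One]) ?w" "prefix (?j @ [One]) (rev ?w)"
      "\<forall>n. length n \<le> length ?w \<longrightarrow> prefix (n @ [One]) ?w \<longrightarrow> n = ?i"
      using single_One_iff[of ?w "length u'" "length v'"] by blast+
    have "n = ?i" if "prefix (n @ [One]) ?w" for n
      using w(3) prefix_length_le[OF that] that by simp
    with w z show ?r by (intro conjI exI[of _ ?i] exI[of _ ?j] exI[of _ ?w]) (auto simp: eq_upto_def)
  qed
  finally show ?thesis .
qed

lemma sat_pair_fm:
  assumes "e y = word (twos m)" "tval F e u = word u'" "tval F e v = word v'" "tval F e z = word z'"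
  shows "sat U F R e (pair_fm y u v z) \<longleftrightarrow> z' = pair u' v' \<and> length z' < m"
proof -
  \<comment> \<open>The value of the term \<open>p\<close>: reversal turns \<open>i @ [One]\<close>
    into \<open>One # rev i\<close>, and a last \<open>One\<close> is appended.\<close>
  let ?p = "\<lambda>i. One # rev i @ [One]"
  have "sat U F R e (pair_fm y u v z) \<longleftrightarrow>
    (\<exists>w. length w \<le> m \<and> (\<exists>i. length i \<le> m \<and> (\<exists>a. length a \<le> m \<and> (\<exists>b. length b \<le> m \<and> (\<exists>c. length c \<le> m \<and>
      (w = u' @ v' \<and> length w < m) \<and> set i \<subseteq> {Two} \<and>
      eq_upto m (length i) (length (w @ [One])) \<and>
      (a = ?p i @ u' \<and> length a < m) \<and> (b = a @ ?p i \<and> length b < m) \<and>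
      (c = b @ v' \<and> length c < m) \<and> (z' = c @ ?p i \<and> length z' < m))))))" (is "_ \<longleftrightarrow> ?r")
    using assms
    by (simp add: pair_fm_def Let_def sat_len_ex[where m = m] numeral_eq_Suc,
        simp add: sat_eq_len_fm[where m = m] sat_cat_fm[where m = m] tval_subst)
  also have "\<dots> \<longleftrightarrow> z' = pair u' v' \<and> length z' < m"
  proof
    assume z: "z' = pair u' v' \<and> length z' < m"
    let ?i = "twos (Suc (length (u' @ v')))"
    show ?r
      by (rule exI[of _ "u' @ v'"], rule conjI[rotated], rule exI[of _ ?i], rule conjI[rotated],
          rule exI[of _ "?p ?i @ u'"], rule conjI[rotated], rule exI[of _ "?p ?i @ u' @ ?p ?i"],
          rule conjI[rotated], rule exI[of _ "?p ?i @ u' @ ?p ?i @ v'"])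
        (use z in \<open>auto simp: eq_upto_def pair_def Let_def marker_def replicate_app_Cons_same\<close>)
  next
    assume ?r
    then obtain w i a b c where w: "w = u' @ v'" "length w < m"
      and i: "set i \<subseteq> {Two}" "eq_upto m (length i) (length (w @ [One]))"
      and z: "a = ?p i @ u'" "b = a @ ?p i" "c = b @ v'" "z' = c @ ?p i" "length z' < m"
      by blast
    \<comment> \<open>As \<open>w\<close> is shorter than \<open>m\<close>, one more letter still
      fits and the comparison of lengths is exact.\<close>
    have "i = twos (Suc (length w))" using i w(2) by (intro twos_eqI) (auto simp: eq_upto_def)
    with w z show "z' = pair u' v' \<and> length z' < m"
      by (simp add: pair_def Let_def marker_def replicate_app_Cons_same)
  qed
  finally show ?thesis .
qed

text \<open>The closure condition climbs through the words \<open>2\<^sup>n\<close> until it meets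
  \<open>e 0\<close>. Climbing past \<open>m\<close> would place \<open>2\<^sup>m\<close> strictly
  below \<open>e 0\<close>, although \<open>\<psi>\<close> holds there.\<close>

lemma sat_minimal_fm:
  assumes "e 0 \<in> U" and \<psi>: "\<And>k. sat U F R (case_nat (word (twos k)) e) \<psi> \<longleftrightarrow> m \<le> k"
  shows "sat U F R e (minimal_fm \<psi>) \<longleftrightarrow> (\<exists>k\<le>m. e 0 = word (twos k))"
proof
  assume "sat U F R e (minimal_fm \<psi>)"
  then have 0: "R Sub [word [], e 0]"
    and step: "\<And>x. x \<in> U \<Longrightarrow> R Sub [x, e 0] \<Longrightarrow> x \<noteq> e 0 \<Longrightarrow>
      R Sub [F (S Two) [x], e 0] \<and> \<not> sat U F R (case_nat x e) \<psi>"
    by (auto simp: minimal_fm_def)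
  have "(\<exists>k<n. e 0 = word (twos k)) \<or> R Sub [word (twos n), e 0]" for n
  proof (induction n)
    case 0
    then show ?case using \<open>R Sub [word [], e 0]\<close> by simp
  next
    case (Suc n)
    have "R Sub [word (twos (Suc n)), e 0]" if "R Sub [word (twos n), e 0]" "e 0 \<noteq> word (twos n)"
      using step[OF word_in that(1)] that(2) by (simp add: replicate_append_same)
    with Suc show ?case by (metis less_Suc_eq)
  qed
  then show "\<exists>k\<le>m. e 0 = word (twos k)"
    using step[of "word (twos m)"] \<psi>[of m] by (metis less_or_eq_imp_le word_in)
next
  assume "\<exists>k\<le>m. e 0 = word (twos k)"
  then obtain k where k: "k \<le> m" "e 0 = word (twos k)" by blast
  have "\<exists>j<k. s = twos j" if "prefix s (twos k)" "s \<noteq> twos k" for s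
  proof -
    have "length s < k" using that prefix_length_less[of s "twos k"] by (auto simp: strict_prefix_def)
    moreover have "s = twos (length s)"
      using set_mono_prefix[OF that(1)] set_twos by (blast intro: twos_eqI)
    ultimately show ?thesis by blast
  qed
  then have *: "x \<in> U \<Longrightarrow> R Sub [x, e 0] \<Longrightarrow> x \<noteq> e 0 \<Longrightarrow> \<exists>j<k. x = word (twos j)" for x
    using k(2) by (auto simp: sub_word_iff)
  have "prefix (twos (Suc j)) (twos k)" if "j < k" for j
    using that by (metis Suc_leI le_add_diff_inverse prefixI replicate_add)
  then show "sat U F R e (minimal_fm \<psi>)"
    using k * \<psi> by (fastforce simp: minimal_fm_def replicate_append_same)
qed

lemma sat_graph_fm:
  assumes "e 0 = word u" "e 1 = word v" "e 2 \<in> U"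
  shows "sat U F R e graph_fm \<longleftrightarrow> e 2 = word (pair u v)"
proof -
  let ?m = "Suc (length (pair u v))"
  let ?\<psi> = "len_ex 0 (pair_fm 1 (Var 3) (Var 4) (Var 0))"
  have \<psi>: "sat U F R (case_nat (word (twos k)) (case_nat y e)) ?\<psi> \<longleftrightarrow> ?m \<le> k" for k y
  proof -
    have "sat U F R (case_nat (word (twos k)) (case_nat y e)) ?\<psi> \<longleftrightarrow>
        (\<exists>s. length s \<le> k \<and> s = pair u v \<and> length s < k)"
      using assms by (simp add: sat_len_ex[where m = k] sat_pair_fm[where m = k] numeral_eq_Suc)
    then show ?thesis by auto
  qed
  have minimal: "sat U F R (case_nat y e) (minimal_fm ?\<psi>) \<longleftrightarrow> (\<exists>k\<le>?m. y = word (twos k))" if "y \<in> U" for y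
    using sat_minimal_fm[where e = "case_nat y e", OF _ \<psi>] that by simp
  have "sat U F R e graph_fm \<longleftrightarrow> (\<exists>y\<in>U. sat U F R (case_nat y e) (minimal_fm ?\<psi>) \<and> R Len [e 2, y] \<and>
      sat U F R (case_nat y e) (pair_fm 0 (Var 1) (Var 2) (Var 3)))"
    by (auto simp: graph_fm_def numeral_eq_Suc)
  also have "\<dots> \<longleftrightarrow> (\<exists>y\<in>U. (\<exists>k\<le>?m. y = word (twos k)) \<and> R Len [e 2, y] \<and>
      sat U F R (case_nat y e) (pair_fm 0 (Var 1) (Var 2) (Var 3)))"
    using minimal by blast
  also have "\<dots> \<longleftrightarrow> (\<exists>k\<le>?m. R Len [e 2, word (twos k)] \<and>
      sat U F R (case_nat (word (twos k)) e) (pair_fm 0 (Var 1) (Var 2) (Var 3)))"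
    by auto
  \<comment> \<open>A standard bound makes the value \<open>e 2\<close> a standard word, to which
    \<open>sat_pair_fm\<close> applies.\<close>
  also have "\<dots> \<longleftrightarrow> (\<exists>k\<le>?m. \<exists>s. length s \<le> k \<and> e 2 = word s \<and> s = pair u v \<and> length s < k)"
  proof -
    have "R Len [e 2, word (twos k)] \<and>
        sat U F R (case_nat (word (twos k)) e) (pair_fm 0 (Var 1) (Var 2) (Var 3)) \<longleftrightarrow>
        (\<exists>s. length s \<le> k \<and> e 2 = word s \<and> s = pair u v \<and> length s < k)" for k
    proof -
      have "sat U F R (case_nat (word (twos k)) e) (pair_fm 0 (Var 1) (Var 2) (Var 3)) \<longleftrightarrow>
          s = pair u v \<and> length s < k" if "e 2 = word s" for s
        using assms that by (simp add: sat_pair_fm[where m = k and z' = s] numeral_eq_Suc)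
      then show ?thesis unfolding len_twos_iff[OF assms(3)] by blast
    qed
    then show ?thesis by simp
  qed
  \<comment> \<open>The bounds on \<open>k\<close> from both sides leave exactly
    \<open>?m\<close>.\<close>
  also have "\<dots> \<longleftrightarrow> e 2 = word (pair u v)" by auto
  finally show ?thesis .
qed

lemma sat_subtm_fm:
  assumes "e 0 \<in> U" "e 1 = word (code t)"
  shows "sat U F R e subtm_fm \<longleftrightarrow> (\<exists>s\<in>set (subterms t). e 0 = word (code s))"
proof -
  let ?b = "code t"
  let ?m = "Suc (length ?b)"
  let ?\<chi> = "Or (Eq (Var 1) (canon [])) (len_ex 0 (len_ex 1 (pair_fm 2 (Var 1) (Var 0) (Var 3))))"
  let ?\<theta> = "Conj [Exists (And (Rel Sub [Var 0, Var 3]) (Rel Sub [Fn Rv [Var 2], Fn Rv [Var 0]])), ?\<chi>]"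
  have \<psi>: "sat U F R (case_nat (word (twos k)) (case_nat y e)) (Rel Len [Fn (S One) [Var 3], Var 0])
      \<longleftrightarrow> ?m \<le> k" for k y
    using assms by (simp add: numeral_eq_Suc)
  have minimal: "sat U F R (case_nat y e) (minimal_fm (Rel Len [Fn (S One) [Var 3], Var 0]))
      \<longleftrightarrow> (\<exists>k\<le>?m. y = word (twos k))" if "y \<in> U" for y
    using sat_minimal_fm[where e = "case_nat y e", OF _ \<psi>] that by simp
  have "sat U F R e subtm_fm \<longleftrightarrow>
      (\<exists>y\<in>U. sat U F R (case_nat y e) (minimal_fm (Rel Len [Fn (S One) [Var 3], Var 0])) \<and>
        R Len [word (?b @ [One]), y] \<and> R Len [e 0, y] \<and> sat U F R (case_nat y e) ?\<theta>)"
    using assms(2) by (auto simp: subtm_fm_def numeral_eq_Suc)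
  also have "\<dots> \<longleftrightarrow> (\<exists>y\<in>U. (\<exists>k\<le>?m. y = word (twos k)) \<and> R Len [word (?b @ [One]), y] \<and>
      R Len [e 0, y] \<and> sat U F R (case_nat y e) ?\<theta>)"
    using minimal by blast
  \<comment> \<open>Bounding \<open>word (?b @ [One])\<close> requires \<open>k\<close> to be at
    least \<open>?m\<close>, so \<open>y\<close> is exactly \<open>word (twos ?m)\<close>.\<close>
  also have "\<dots> \<longleftrightarrow> R Len [e 0, word (twos ?m)] \<and> sat U F R (case_nat (word (twos ?m)) e) ?\<theta>"
    by (auto simp: le_Suc_eq simp del: sat.simps sat_Conj replicate_Suc)
  also have "\<dots> \<longleftrightarrow> (\<exists>x. length x \<le> ?m \<and> e 0 = word x \<and> sublist x ?b \<and>
      (x = [] \<or> (\<exists>u v. length u \<le> ?m \<and> length v \<le> ?m \<and> x = pair u v \<and> length x < ?m)))"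
  proof -
    have "sat U F R (case_nat (word (twos ?m)) e) ?\<theta> \<longleftrightarrow> sublist x ?b \<and>
      (x = [] \<or> (\<exists>u v. length u \<le> ?m \<and> length v \<le> ?m \<and> x = pair u v \<and> length x < ?m))"
      if x: "e 0 = word x" for x
    proof -
      have "sat U F R (case_nat (word (twos ?m)) e) ?\<chi> \<longleftrightarrow>
        x = [] \<or> (\<exists>u v. length u \<le> ?m \<and> length v \<le> ?m \<and> x = pair u v \<and> length x < ?m)"
        using x by (auto simp: sat_len_ex[where m = ?m] sat_pair_fm[where m = ?m] numeral_eq_Suc
            simp del: replicate_Suc)
      moreover have "(\<exists>y\<in>U. R Sub [y, word ?b] \<and> R Sub [word (rev x), F Rv [y]]) \<longleftrightarrow> sublist x ?b"
        by (auto simp: sub_word_iff sublist_altdef suffix_to_prefix)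
      ultimately show ?thesis using x assms by (simp add: numeral_eq_Suc)
    qed
    then show ?thesis using len_twos_iff[OF assms(1), of ?m] by blast
  qed
  also have "\<dots> \<longleftrightarrow> (\<exists>x. e 0 = word x \<and> sublist x ?b \<and> (x = [] \<or> (\<exists>u v. x = pair u v)))"
  proof -
    \<comment> \<open>A pair is longer than its components, so for a factor of \<open>?b\<close> all
      length bounds hold automatically.\<close>
    have "length x \<le> ?m \<and> e 0 = word x \<and> sublist x ?b \<and>
        (x = [] \<or> (\<exists>u v. length u \<le> ?m \<and> length v \<le> ?m \<and> x = pair u v \<and> length x < ?m)) \<longleftrightarrow>
      e 0 = word x \<and> sublist x ?b \<and> (x = [] \<or> (\<exists>u v. x = pair u v))" for x
    proof (cases "sublist x ?b")
      case True
      from sublist_length_le[OF this] show ?thesis by (auto simp: length_pair)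
    qed simp
    then show ?thesis by simp
  qed
  also have "\<dots> \<longleftrightarrow> (\<exists>s\<in>set (subterms t). e 0 = word (code s))"
    unfolding sublist_code_iff by auto
  finally show ?thesis .
qed

section \<open>The structure of trees defined inside a model\<close>

definition graph :: "'a \<Rightarrow> 'a \<Rightarrow> 'a \<Rightarrow> bool" where
  "graph x y z \<longleftrightarrow> sat U F R (case_nat x (case_nat y (\<lambda>_. z))) graph_fm"

definition tern :: "'a \<Rightarrow> 'a \<Rightarrow> 'a \<Rightarrow> bool" where
  "tern x y z \<longleftrightarrow> (\<forall>w\<in>U. graph x y w \<longleftrightarrow> w = z) \<or>
    \<not> (\<exists>v\<in>U. \<forall>w\<in>U. graph x y w \<longleftrightarrow> w = v) \<and> z = word []"

definition subtm :: "'a \<Rightarrow> 'a \<Rightarrow> bool" where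
  "subtm x y \<longleftrightarrow> sat U F R (case_nat x (\<lambda>_. y)) subtm_fm"

lemma graph_word: "z \<in> U \<Longrightarrow> graph (word u) (word v) z \<longleftrightarrow> z = word (pair u v)"
  unfolding graph_def by (subst sat_graph_fm[of _ u v]) (auto simp: numeral_eq_Suc)

lemma tern_word: "tern (word u) (word v) (word (pair u v))"
  by (auto simp: tern_def graph_word)

lemma tern_total: "\<exists>z\<in>U. tern x y z"
  unfolding tern_def by (metis word_in)

text \<open>The two alternatives exclude each other, and each fixes the value.\<close>

lemma tern_unique: "tern x y u \<Longrightarrow> tern x y v \<Longrightarrow> u \<in> U \<Longrightarrow> v \<in> U \<Longrightarrow> u = v"
  unfolding tern_def by metis

lemma subtm_word: "x \<in> U \<Longrightarrow> subtm x (word (code t)) \<longleftrightarrow> (\<exists>s\<in>set (subterms t). x = word (code s))"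
  unfolding subtm_def by (subst sat_subtm_fm[of _ t]) auto

lemma sat_app_graph: "sat U F R e (app_fm graph_fm [Var a, Var b, Var c]) \<longleftrightarrow> graph (e a) (e b) (e c)"
  unfolding sat_app_fm graph_def
  by (rule sat_cong) (use fv_graph_fm in \<open>auto simp: numeral_eq_Suc\<close>)

lemma sat_unique_fm: "sat U F R e (unique_fm a b z) \<longleftrightarrow> (\<forall>w\<in>U. graph (e a) (e b) w \<longleftrightarrow> w = e z)"
  by (auto simp: unique_fm_def sat_app_graph)

lemma sat_tern_fm: "sat U F R e tern_fm \<longleftrightarrow> tern (e 0) (e 1) (e 2)"
  by (auto simp: tern_fm_def tern_def sat_unique_fm)

lemma sat_subtm_fm_iff: "sat U F R e subtm_fm \<longleftrightarrow> subtm (e 0) (e 1)"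
  unfolding subtm_def by (rule sat_cong) (use fv_subtm_fm in auto)

definition tree_fun :: "wt_fun \<Rightarrow> 'a list \<Rightarrow> 'a" where
  "tree_fun f xs = (case f of Const t \<Rightarrow> word (code t))"

definition tree_rel :: "wt_rel \<Rightarrow> 'a list \<Rightarrow> bool" where
  "tree_rel r xs = (case r of Tern \<Rightarrow> tern (xs ! 0) (xs ! 1) (xs ! 2) | Subtm \<Rightarrow> subtm (xs ! 0) (xs ! 1))"

lemma tval_tree_in: "(\<And>i. e i \<in> U) \<Longrightarrow> tval tree_fun e t \<in> U"
  by (cases t) (auto simp: tree_fun_def split: wt_fun.splits)

text \<open>All function symbols of \<open>WT_lang\<close> are constants, so no nested values
  arise.\<close>

lemma sat_tr_tm:
  assumes "wf_tm WT_lang t"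
  shows "sat U F R e (tr_tm wt_translation t) \<longleftrightarrow> e 0 = tval tree_fun (\<lambda>i. e (Suc i)) t"
proof (cases t)
  case (Fn f ts)
  with assms have "ts = []" by (simp add: WT_lang_def)
  with Fn show ?thesis
    by (cases f) (simp add: with_values_def Existss_def sat_app_fm wt_translation_def tree_fun_def)
qed simp

lemma sat_dom_tr [simp]: "sat U F R e (app_fm (dom_tr wt_translation) ts)"
  by (simp add: app_fm_def wt_translation_def)

lemma sat_subst_tr_tm:
  "wf_tm WT_lang t \<Longrightarrow>
    sat U F R e (subst_fm (case_nat (Var i) (\<lambda>j. Var (s j))) (tr_tm wt_translation t)) \<longleftrightarrow>
    e i = tval tree_fun (\<lambda>j. e (s j)) t"
  by (simp add: sat_subst sat_tr_tm)

text \<open>Term values lie in the domain and are unique, which removes the existential quantifiers.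
  Two terms cover identity and \<open>Subtm\<close>; three cover \<open>Tern\<close>.\<close>

lemma sat_with_values_2:
  assumes "wf_tm WT_lang s" "wf_tm WT_lang t" "\<And>i. e i \<in> U"
  shows "sat U F R e (with_values wt_translation 0 (map (tr_tm wt_translation) [s, t]) \<psi>) \<longleftrightarrow>
    sat U F R (case_nat (tval tree_fun e s) (case_nat (tval tree_fun e t) e)) \<psi>"
  using tval_tree_in[where e = e, OF assms(3)] assms(1,2)
  by (simp add: with_values_def Existss_def numeral_eq_Suc sat_subst_tr_tm)

lemma sat_with_values_3:
  assumes "wf_tm WT_lang s" "wf_tm WT_lang t" "wf_tm WT_lang u" "\<And>i. e i \<in> U"
  shows "sat U F R e (with_values wt_translation 0 (map (tr_tm wt_translation) [s, t, u]) \<psi>) \<longleftrightarrow>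
    sat U F R (case_nat (tval tree_fun e s) (case_nat (tval tree_fun e t) (case_nat (tval tree_fun e u) e))) \<psi>"
  using tval_tree_in[where e = e, OF assms(4)] assms(1-3)
  by (simp add: with_values_def Existss_def numeral_eq_Suc sat_subst_tr_tm)

text \<open>Reduces the translated axioms to truth in the structure given by \<open>tree_fun\<close>
  and \<open>tree_rel\<close>.\<close>

lemma sat_tr_fm:
  assumes "wf_fm WT_lang \<phi>" "\<And>i. e i \<in> U"
  shows "sat U F R e (tr_fm wt_translation \<phi>) \<longleftrightarrow> sat U tree_fun tree_rel e \<phi>"
  using assms
proof (induction \<phi> arbitrary: e)
  case (Eq s t)
  then show ?case using sat_with_values_2[of s t e] by simp
next
  case (Rel r ts)
  show ?case
  proof (cases r)
    case Tern
    then obtain s t u where ts: "ts = [s, t, u]"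
      using Rel by (auto simp: WT_lang_def numeral_eq_Suc length_Suc_conv)
    have "sat U F R e (tr_fm wt_translation (Rel r ts)) \<longleftrightarrow>
        tern (tval tree_fun e s) (tval tree_fun e t) (tval tree_fun e u)"
      unfolding tr_fm.simps ts using Rel ts sat_with_values_3[of s t u e]
      by (simp add: sat_app_fm Tern wt_translation_def sat_tern_fm numeral_eq_Suc)
    then show ?thesis by (simp add: ts Tern tree_rel_def numeral_eq_Suc)
  next
    case Subtm
    then obtain s t where ts: "ts = [s, t]"
      using Rel by (auto simp: WT_lang_def numeral_eq_Suc length_Suc_conv)
    have "sat U F R e (tr_fm wt_translation (Rel r ts)) \<longleftrightarrow>
        subtm (tval tree_fun e s) (tval tree_fun e t)"
      unfolding tr_fm.simps ts using Rel ts sat_with_values_2[of s t e]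
      by (simp add: sat_app_fm Subtm wt_translation_def sat_subtm_fm_iff numeral_eq_Suc)
    then show ?thesis by (simp add: ts Subtm tree_rel_def numeral_eq_Suc)
  qed
next
  case (Forall \<phi>)
  have "sat U F R (case_nat x e) (tr_fm wt_translation \<phi>) \<longleftrightarrow> sat U tree_fun tree_rel (case_nat x e) \<phi>"
    if "x \<in> U" for x
    by (rule Forall.IH) (use Forall.prems that in \<open>auto split: nat.splits\<close>)
  then show ?case by simp
qed auto

lemma tree_model:
  assumes "\<phi> \<in> WT_Rel" "\<And>i. e i \<in> U"
  shows "sat U tree_fun tree_rel e \<phi>"
  using assms(1)
proof induction
  case (WT1 s t)
  then show ?case by (simp add: tree_fun_def)
next
  case (WT2 t)
  then show ?case by (auto simp: tree_fun_def tree_rel_def subtm_word sat_Disj)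
next
  case (WT3 s t)
  then show ?case by (simp add: tree_fun_def tree_rel_def tern_word)
next
  case WT4
  then show ?case using tern_total by (auto simp: tree_rel_def numeral_eq_Suc)
next
  case WT5
  then show ?case using tern_unique by (auto simp: tree_rel_def Foralls_def numeral_eq_Suc)
qed

end

section \<open>Well-formedness of translated formulas\<close>

lemma wf_app_fm: "wf_fm L \<phi> \<Longrightarrow> (\<And>t. t \<in> set ts \<Longrightarrow> wf_tm L t) \<Longrightarrow> wf_fm L (app_fm \<phi> ts)"
  unfolding app_fm_def by (rule wf_subst_fm) auto

lemma wf_Existss: "wf_fm L (Existss n \<phi>) \<longleftrightarrow> wf_fm L \<phi>"
  by (induction n) (auto simp: Existss_def)

lemma wf_foldr_And: "wf_fm L (foldr And \<phi>s \<psi>) \<longleftrightarrow> (\<forall>\<phi>\<in>set \<phi>s. wf_fm L \<phi>) \<and> wf_fm L \<psi>"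
  by (induction \<phi>s) auto

lemma wf_with_values:
  assumes "wf_fm L (dom_tr I)" "\<forall>v\<in>set vs. wf_fm L v" "wf_fm L \<psi>"
  shows "wf_fm L (with_values I c vs \<psi>)"
  using assms
  by (auto simp: with_values_def Let_def wf_Existss wf_foldr_And dest!: set_zip_rightD
      intro!: wf_app_fm wf_subst_fm split: nat.splits)

lemma wf_tr_tm: "wf_translation L L' I \<Longrightarrow> wf_fm L' (tr_tm I t)"
  by (induction t) (auto simp: wf_translation_def simp del: upt_Suc intro!: wf_with_values wf_app_fm)

lemma wf_tr_fm: "wf_translation L L' I \<Longrightarrow> wf_fm L' (tr_fm I \<phi>)"
proof (induction \<phi>)
  case (Eq s t)
  then show ?case using wf_tr_tm[OF Eq] by (auto simp: wf_translation_def intro!: wf_with_values)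
next
  case (Rel r ts)
  then show ?case using wf_tr_tm[OF Rel]
    by (auto simp: wf_translation_def intro!: wf_with_values wf_app_fm)
next
  case (Forall \<phi>)
  then show ?case by (auto simp: wf_translation_def intro!: wf_app_fm)
qed auto

section \<open>From truth in all models to provability\<close>

instance digit :: countable by countable_datatype
instance vw_fun :: countable by countable_datatype
instance vw_rel :: countable by countable_datatype

lemma VW_plus_derives:
  assumes "wf_fm VW_lang \<phi>"
    and "\<And>(U :: vw_fun tm set set) F R e. vw_model U F R e \<Longrightarrow> sat U F R e \<phi>"
  shows "VW_lang, VW_plus \<turnstile> \<phi>"
  using assms by (intro completeness) (auto simp: vw_model_def sentence_VW_plus)

theorem theorem3p7:
  shows "interpretable WT_lang WT_Rel VW_lang VW_plus"
  unfolding interpretable_def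
proof (intro exI conjI allI ballI)
  show "wf_translation WT_lang VW_lang wt_translation" by (rule wf_translation_wt)
  show "VW_lang, VW_plus \<turnstile> dom_nonempty wt_translation"
  proof (rule VW_plus_derives)
    fix U :: "vw_fun tm set set" and F R e
    assume "vw_model U F R e"
    then interpret vw_model U F R e .
    show "sat U F R e (dom_nonempty wt_translation)"
      using env by (auto simp: dom_nonempty_def)
  qed (simp add: dom_nonempty_def app_fm_def wt_translation_def)
  show "VW_lang, VW_plus \<turnstile> functional WT_lang wt_translation f" for f
  proof (rule VW_plus_derives)
    obtain t where f: "f = Const t" by (cases f)
    have arity: "fun_arity WT_lang g = 0" for g by (simp add: WT_lang_def)
    have canon: "subst_tm \<sigma> (canon w) = canon w" for \<sigma> :: "nat \<Rightarrow> vw_fun tm" and w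
      using subst_tm_cong[of "canon w" \<sigma> Var] by simp
    show "wf_fm VW_lang (functional WT_lang wt_translation f)"
      by (simp add: functional_def Let_def arity Foralls_def app_fm_def wt_translation_def f canon)
    fix U :: "vw_fun tm set set" and F R e
    assume "vw_model U F R e"
    then interpret vw_model U F R e .
    show "sat U F R e (functional WT_lang wt_translation f)"
      by (simp add: functional_def Let_def arity Foralls_def sat_app_fm)
        (simp add: wt_translation_def f)
  qed
  show "VW_lang, VW_plus \<turnstile> tr_fm wt_translation \<phi>" if "\<phi> \<in> WT_Rel" for \<phi>
  proof (rule VW_plus_derives)
    show "wf_fm VW_lang (tr_fm wt_translation \<phi>)" by (rule wf_tr_fm[OF wf_translation_wt])
    fix U :: "vw_fun tm set set" and F R e
    assume "vw_model U F R e"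
    then interpret vw_model U F R e .
    have "wf_fm WT_lang \<phi>" using sentence_WT_Rel[OF that] by (simp add: sentence_def)
    then show "sat U F R e (tr_fm wt_translation \<phi>)"
      using tree_model[OF that env] by (simp add: sat_tr_fm env)
  qed
qed

end
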